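(* Let $x\in\mathbb{R}^N$ and let $J,G:\mathbb{R}^N\to\mathbb{R}$ be finite-valued convex functions with $$J\in \mathrm{PSFL}_x(\Gamma^J,f^J,\nu_x^J,\mu_x^J,\tau_x^J,\xi_x^J),\qquad G\in \mathrm{PSFL}_x(\Gamma^G,f^G,\nu_x^G,\mu_x^G,\tau_x^G,\xi_x^G).$$ Let $H=J+G$, and write $T^J,T^G,T^H$ for the model subspaces of $J,G,H$ at $x$ and $S^H=(T^H)^\perp$. Then, with the choice $f^H=f^J+f^G$ and $\Gamma^H=\max(\Gamma^J,\Gamma^G)$, one has $$H\in \mathrm{PSFL}_x(\Gamma^H,f^H,\nu_x^H,\mu_x^H,\tau_x^H,\xi_x^H)$$ with $$\nu_x^H=\min(\nu_x^J,\nu_x^G),$$ $$\mu_x^H=\mu_x^J\,|||P_{T^H}|||_{\Gamma^J\to\Gamma^H}+\mu_x^G\,|||P_{T^H}|||_{\Gamma^G\to\Gamma^H},$$ $$\tau_x^H=\tau_x^J+\tau_x^G+\mu_x^J\,|||P_{S^H\cap T^J}|||_{\Gamma^J\to H_{f_x^H}^{x,\circ}}+\mu_x^G\,|||P_{S^H\cap T^G}|||_{\Gamma^G\to H_{f_x^H}^{x,\circ}},$$ $$\xi_x^H=\max(\xi_x^J,\xi_x^G).$$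
   Context: Model subspace: for a finite-valued convex $J$ on $\mathbb{R}^N$ and $x\in\mathbb{R}^N$, $\bar S_x$ is the affine hull of $\partial J(x)$; $e_x$ is the orthogonal projection of $0$ onto $\bar S_x$; $S_x=\bar S_x-e_x$ (a linear subspace); $T_x=S_x^\perp$. Quantities attached to different functions are distinguished by a superscript. $P_V$ is the orthogonal projector onto $V$. Gauges: for a closed convex $C\ni0$, $\gamma_C(u)=\inf\{\lambda>0:u\in\lambda C\}$ ($\inf\emptyset=+\infty$). For $f_x\in\operatorname{ri}\partial J(x)$ the subdifferential gauge is $J_{f_x}^{x,\circ}=\gamma_{\partial J(x)-f_x}$; it is finite and coercive on $S_x$ and $+\infty$ elsewhere. A gauge is coercive on a subspace if it tends to $+\infty$ as the norm of its argument in that subspace tends to infinity. Operator bound: for gauges $\Gamma_1,\Gamma_2$ finite on subspaces $V_1,V_2$ and linear $A:V_1\to V_2$, $|||A|||_{\Gamma_1\to\Gamma_2}=\sup_{v\in V_1,\ \Gamma_1(v)\le1}\Gamma_2(Av)$ (here $\Gamma^J$, $\Gamma^G$, $\Gamma^H$ are considered on $T^J,T^G,T^H$ and $H_{f_x^H}^{x,\circ}$ on $S^H$). Partial smoothness: a finite-valued convex $J$ is partly smooth at $x$ relative to a set $\mathcal M\ni x$ if (1) $\mathcal M$ is a $C^2$-manifold around $x$ and $J$ restricted to $\mathcal M$ is $C^2$ around $x$; (2) the tangent space of $\mathcal M$ at $x$ is $T_x$; (3) the set-valued map $\partial J$ is continuous at $x$ relative to $\mathcal M$. The class $\mathrm{PSFL}_x(\Gamma,f,\nu_x,\mu_x,\tau_x,\xi_x)$: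 $\Gamma$ is a gauge that is finite and coercive on $T_x$; $\nu_x,\mu_x,\tau_x,\xi_x$ are non-negative reals; $J$ is finite-valued, convex, partly smooth at $x$ relative to $\mathcal M=T_x$; $\partial J$ is Lipschitz-continuous around $x$ relative to $T_x$ (there are $\beta\ge0$ and a neighbourhood $U$ of $x$ with $\partial J(z')\subseteq\partial J(z)+\beta\|z-z'\|\mathbb B$ for all $z,z'\in T_x\cap U$, $\mathbb B$ the closed unit ball); $f:x'\mapsto f_{x'}\in\operatorname{ri}\partial J(x')$ is a Lipschitz-continuous map on a neighbourhood of $x$ in $T_x$ containing all $x'\in T_x$ with $\Gamma(x-x')<\nu_x$; and, with $S=S_x$: for every $x'\in T_x$ with $\Gamma(x-x')\le\nu_x$ one has $T_{x'}=T_x$, and for every $x'\in T_x$ with $\Gamma(x-x')<\nu_x$, $$\Gamma(e_x-e_{x'})\le\mu_x\Gamma(x-x'),\qquad J_{f_x}^{x,\circ}(P_S(f_x-f_{x'}))\le\tau_x\Gamma(x-x'),\qquad \sup_{u\in S,\,u\ne0}\frac{J_{f_{x'}}^{x',\circ}(u)-J_{f_x}^{x,\circ}(u)}{J_{f_x}^{x,\circ}(u)}\le\xi_x\Gamma(x-x').$$ *)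

theory Defs
  imports "HOL-Analysis.Analysis"
begin

definition subdifferential :: "('a::euclidean_space \<Rightarrow> real) \<Rightarrow> 'a \<Rightarrow> 'a set" where
  "subdifferential J x = {u. \<forall>y. J x + u \<bullet> (y - x) \<le> J y}"

subsection \<open>Model subspaces\<close>

definition model_affine :: "('a::euclidean_space \<Rightarrow> real) \<Rightarrow> 'a \<Rightarrow> 'a set" where
  "model_affine J x = affine hull subdifferential J x"

definition model_e :: "('a::euclidean_space \<Rightarrow> real) \<Rightarrow> 'a \<Rightarrow> 'a" where
  "model_e J x = closest_point (model_affine J x) 0"

definition model_S :: "('a::euclidean_space \<Rightarrow> real) \<Rightarrow> 'a \<Rightarrow> 'a set" where
  "model_S J x = (\<lambda>u. u - model_e J x) ` model_affine J x"

definition model_T :: "('a::euclidean_space \<Rightarrow> real) \<Rightarrow> 'a \<Rightarrow> 'a set" where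
  "model_T J x = orthogonal_comp (model_S J x)"

text \<open>The orthogonal projector onto a linear subspace \<open>V\<close> is \<open>closest_point V\<close>.\<close>

subsection \<open>Gauges\<close>

text \<open>Values are extended reals, so that the infimum of the empty set is \<open>\<infinity>\<close>.\<close>

definition gauge_fun :: "'a::euclidean_space set \<Rightarrow> 'a \<Rightarrow> ereal" where
  "gauge_fun C u = (INF l\<in>{l::real. 0 < l \<and> u \<in> (\<lambda>c. l *\<^sub>R c) ` C}. ereal l)"

definition is_gauge :: "('a::euclidean_space \<Rightarrow> ereal) \<Rightarrow> bool" where
  "is_gauge \<Gamma> \<longleftrightarrow> (\<exists>C. closed C \<and> convex C \<and> 0 \<in> C \<and> \<Gamma> = gauge_fun C)"

definition finite_on :: "('a::euclidean_space \<Rightarrow> ereal) \<Rightarrow> 'a set \<Rightarrow> bool" where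
  "finite_on \<Gamma> V \<longleftrightarrow> (\<forall>v\<in>V. \<Gamma> v < \<infinity>)"

definition coercive_on :: "('a::euclidean_space \<Rightarrow> ereal) \<Rightarrow> 'a set \<Rightarrow> bool" where
  "coercive_on \<Gamma> V \<longleftrightarrow> (\<Gamma> \<longlongrightarrow> \<infinity>) (inf at_infinity (principal V))"

text \<open>The subdifferential gauge at \<open>x\<close>; the third argument is the vector \<open>f\<^sub>x\<close>.\<close>

definition subdiff_gauge ::
    "('a::euclidean_space \<Rightarrow> real) \<Rightarrow> 'a \<Rightarrow> 'a \<Rightarrow> 'a \<Rightarrow> ereal" where
  "subdiff_gauge J x p = gauge_fun ((\<lambda>u. u - p) ` subdifferential J x)"

text \<open>Operator bound of a map \<open>A\<close> defined on the subspace \<open>V1\<close>.\<close>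

definition op_bound ::
    "'a::euclidean_space set \<Rightarrow> ('a \<Rightarrow> ereal) \<Rightarrow> ('b::euclidean_space \<Rightarrow> ereal) \<Rightarrow> ('a \<Rightarrow> 'b) \<Rightarrow> ereal" where
  "op_bound V1 \<Gamma>1 \<Gamma>2 A = (SUP v\<in>{v\<in>V1. \<Gamma>1 v \<le> 1}. \<Gamma>2 (A v))"

subsection \<open>Partial smoothness\<close>

text \<open>Twice continuous (Frechet) differentiability, meant for open \<open>V\<close>.\<close>

definition C2_on :: "('a::euclidean_space \<Rightarrow> 'b::real_normed_vector) \<Rightarrow> 'a set \<Rightarrow> bool" where
  "C2_on F V \<longleftrightarrow>
     (\<exists>(F' :: 'a \<Rightarrow> 'a \<Rightarrow>\<^sub>L 'b) (F'' :: 'a \<Rightarrow> 'a \<Rightarrow>\<^sub>L 'a \<Rightarrow>\<^sub>L 'b).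
        (\<forall>y\<in>V. (F has_derivative blinfun_apply (F' y)) (at y)) \<and>
        (\<forall>y\<in>V. (F' has_derivative blinfun_apply (F'' y)) (at y)) \<and>
        continuous_on V F'')"

text \<open>Around \<open>x\<close>, the set \<open>M\<close> is the zero set of a \<open>C\<^sup>2\<close> submersion. The codimension is not
  known in advance, so the submersion takes its values in a linear subspace \<open>W\<close> of the
  ambient space, in place of the space of \<open>m\<close>-tuples with \<open>m\<close> the dimension of \<open>W\<close>.\<close>

definition C2_manifold_around :: "'a::euclidean_space set \<Rightarrow> 'a \<Rightarrow> bool" where
  "C2_manifold_around M x \<longleftrightarrow> x \<in> M \<and>
     (\<exists>V W (F :: 'a \<Rightarrow> 'a). open V \<and> x \<in> V \<and> subspace W \<and> F ` V \<subseteq> W \<and> C2_on F V \<and>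
        (\<forall>y\<in>V. range (frechet_derivative F (at y)) = W) \<and>
        M \<inter> V = {y\<in>V. F y = 0})"

text \<open>The restriction of \<open>J\<close> to \<open>M\<close> is \<open>C\<^sup>2\<close> around \<open>x\<close>: it has a local \<open>C\<^sup>2\<close> extension.\<close>

definition C2_restriction_around ::
    "('a::euclidean_space \<Rightarrow> real) \<Rightarrow> 'a set \<Rightarrow> 'a \<Rightarrow> bool" where
  "C2_restriction_around J M x \<longleftrightarrow>
     (\<exists>V g. open V \<and> x \<in> V \<and> C2_on g V \<and> (\<forall>y\<in>M \<inter> V. g y = J y))"

text \<open>Velocities at \<open>x\<close> of \<open>C\<^sup>1\<close> curves in \<open>M\<close>.\<close>

definition tangent_space :: "'a::euclidean_space set \<Rightarrow> 'a \<Rightarrow> 'a set" where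
  "tangent_space M x =
     {vector_derivative c (at 0) |c. c 0 = x \<and>
        (\<exists>\<epsilon>>0. c C1_differentiable_on {-\<epsilon><..<\<epsilon>} \<and> c ` {-\<epsilon><..<\<epsilon>} \<subseteq> M)}"

text \<open>Painleve-Kuratowski continuity of a set-valued map at \<open>x\<close> relative to \<open>M\<close>: outer and
  inner semicontinuity.\<close>

definition setvalued_continuous_rel ::
    "('a::euclidean_space \<Rightarrow> 'b::euclidean_space set) \<Rightarrow> 'a \<Rightarrow> 'a set \<Rightarrow> bool" where
  "setvalued_continuous_rel F x M \<longleftrightarrow>
     (\<forall>y v u. (\<forall>k::nat. y k \<in> M \<and> v k \<in> F (y k)) \<and> y \<longlonglongrightarrow> x \<and> v \<longlonglongrightarrow> u \<longrightarrow> u \<in> F x) \<and>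
     (\<forall>y. \<forall>u\<in>F x. (\<forall>k::nat. y k \<in> M) \<and> y \<longlonglongrightarrow> x \<longrightarrow>
        (\<exists>v. (\<forall>\<^sub>F k in sequentially. v k \<in> F (y k)) \<and> v \<longlonglongrightarrow> u))"

definition partly_smooth :: "('a::euclidean_space \<Rightarrow> real) \<Rightarrow> 'a \<Rightarrow> 'a set \<Rightarrow> bool" where
  "partly_smooth J x M \<longleftrightarrow>
     convex_on UNIV J \<and> x \<in> M \<and>
     C2_manifold_around M x \<and> C2_restriction_around J M x \<and>
     tangent_space M x = model_T J x \<and>
     setvalued_continuous_rel (subdifferential J) x M"

subsection \<open>The class PSFL\<close>

definition subdiff_lipschitz_around ::
    "('a::euclidean_space \<Rightarrow> real) \<Rightarrow> 'a \<Rightarrow> 'a set \<Rightarrow> bool" where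
  "subdiff_lipschitz_around J x T \<longleftrightarrow>
     (\<exists>\<beta>\<ge>0. \<exists>U. open U \<and> x \<in> U \<and>
        (\<forall>z\<in>T \<inter> U. \<forall>z'\<in>T \<inter> U. subdifferential J z' \<subseteq>
           {a + (\<beta> * norm (z - z')) *\<^sub>R b |a b. a \<in> subdifferential J z \<and> b \<in> cball 0 1}))"

text \<open>The set \<open>D\<close> is the neighbourhood of \<open>x\<close> in \<open>T\<close> on which \<open>f\<close> is a Lipschitz selection;
  values of \<open>f\<close> outside \<open>D\<close> are irrelevant.\<close>

definition lipschitz_ri_selection ::
    "('a::euclidean_space \<Rightarrow> real) \<Rightarrow> 'a \<Rightarrow> 'a set \<Rightarrow> ('a \<Rightarrow> ereal) \<Rightarrow> ereal \<Rightarrow> ('a \<Rightarrow> 'a) \<Rightarrow> bool" where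
  "lipschitz_ri_selection J x T \<Gamma> \<nu> f \<longleftrightarrow>
     (\<exists>D\<subseteq>T. (\<exists>U. open U \<and> x \<in> U \<and> T \<inter> U \<subseteq> D) \<and>
        {x'\<in>T. \<Gamma> (x - x') < \<nu>} \<subseteq> D \<and>
        (\<forall>x'\<in>D. f x' \<in> rel_interior (subdifferential J x')) \<and>
        (\<exists>L. L-lipschitz_on D f))"

text \<open>The four constants are nonnegative real numbers. They are typed as extended reals, with
  finiteness required explicitly, because operator bounds are suprema in the extended reals.
  In the last condition the supremum over the empty set (the case \<open>S = {0}\<close>) is \<open>- \<infinity>\<close>.\<close>

definition PSFL ::
    "'a::euclidean_space \<Rightarrow> ('a \<Rightarrow> ereal) \<Rightarrow> ('a \<Rightarrow> 'a) \<Rightarrow> ereal \<Rightarrow> ereal \<Rightarrow> ereal \<Rightarrow> ereal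
      \<Rightarrow> ('a \<Rightarrow> real) set" where
  "PSFL x \<Gamma> f \<nu> \<mu> \<tau> \<xi> = {J.
     convex_on UNIV J \<and>
     is_gauge \<Gamma> \<and> finite_on \<Gamma> (model_T J x) \<and> coercive_on \<Gamma> (model_T J x) \<and>
     0 \<le> \<nu> \<and> \<nu> < \<infinity> \<and> 0 \<le> \<mu> \<and> \<mu> < \<infinity> \<and> 0 \<le> \<tau> \<and> \<tau> < \<infinity> \<and> 0 \<le> \<xi> \<and> \<xi> < \<infinity> \<and>
     partly_smooth J x (model_T J x) \<and>
     subdiff_lipschitz_around J x (model_T J x) \<and>
     lipschitz_ri_selection J x (model_T J x) \<Gamma> \<nu> f \<and>
     (\<forall>x'\<in>model_T J x. \<Gamma> (x - x') \<le> \<nu> \<longrightarrow> model_T J x' = model_T J x) \<and>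
     (\<forall>x'\<in>model_T J x. \<Gamma> (x - x') < \<nu> \<longrightarrow>
        \<Gamma> (model_e J x - model_e J x') \<le> \<mu> * \<Gamma> (x - x') \<and>
        subdiff_gauge J x (f x) (closest_point (model_S J x) (f x - f x')) \<le> \<tau> * \<Gamma> (x - x') \<and>
        (SUP u\<in>model_S J x - {0}.
           (subdiff_gauge J x' (f x') u - subdiff_gauge J x (f x) u) / subdiff_gauge J x (f x) u)
          \<le> \<xi> * \<Gamma> (x - x'))}"

end

theory Submission
  imports Defs
begin

text \<open>A vector \<open>t\<close> lies in the model subspace \<open>T\<close> of \<open>J\<close> at \<open>x\<close> exactly when the functional
\<open>u \<mapsto> t \<bullet> u\<close> is constant on the subdifferential (\<open>model_T_iff\<close>), and \<open>e\<close> is the projection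
onto \<open>T\<close> of any subgradient (\<open>closest_point_model_T\<close>). For finite convex functions the
subdifferential of \<open>H = J + G\<close> is the Minkowski sum of the subdifferentials
(\<open>subdifferential_add\<close>, by separating an epigraph from a hypograph). Hence \<open>T\<^sup>H\<close> is the
intersection of \<open>T\<^sup>J\<close> and \<open>T\<^sup>G\<close>, and \<open>e\<^sup>H\<close> is the projection of \<open>e\<^sup>J + e\<^sup>G\<close> onto \<open>T\<^sup>H\<close>. As
\<open>T\<^sup>H\<close> does not change along the admissible points \<open>x'\<close>, the difference of the vectors \<open>e\<^sup>H\<close>
at \<open>x\<close> and \<open>x'\<close> is the projected sum of the two differences, and the operator bounds give
\<open>\<mu>\<^sup>H\<close>.

For \<open>\<tau>\<^sup>H\<close>, split \<open>f\<^sup>J\<^sub>x - f\<^sup>J\<^sub>x'\<close> along \<open>S\<^sup>J\<close> and \<open>T\<^sup>J\<close>; the second part is the difference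
of the vectors \<open>e\<^sup>J\<close>. Since \<open>S\<^sup>J \<subseteq> S\<^sup>H\<close>, the projection onto \<open>S\<^sup>H\<close> keeps the first part and
acts on the second as the projection onto \<open>S\<^sup>H \<inter> T\<^sup>J\<close> (\<open>closest_point_orthogonal_split\<close>).
The first part is measured by \<open>\<tau>\<^sup>J\<close>, because the subdifferential gauge of \<open>H\<close> is at most that
of \<open>J\<close>: the set \<open>\<partial>J - f\<^sup>J\<close> is contained in \<open>\<partial>H - f\<^sup>H\<close>. The second part is measured by \<open>\<mu>\<^sup>J\<close>
and an operator bound.

For \<open>\<xi>\<^sup>H\<close>, the bound on the relative increase says that the gauge at \<open>x'\<close> is at most
\<open>1 + c\<close> times the gauge at \<open>x\<close>. If this holds for two pairs of sets, then it holds for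
their Minkowski sums (\<open>gauge_fun_set_plus_ratio_le\<close>), because a vector of \<open>r (A + B)\<close> splits
into one of \<open>r A\<close> and one of \<open>r B\<close>, each of which is rescaled by at most \<open>1 + c\<close>.

The constants are finite because a coercive gauge has a bounded unit sublevel set, while a
gauge that is finite on a subspace is dominated there by a multiple of the norm
(\<open>op_bound_finite\<close>). The remaining requirements are additive: a linear subspace is a
manifold with itself as tangent space, Lipschitz constants add, and the relative interior of
a Minkowski sum of convex sets is the sum of the relative interiors.\<close>

section \<open>Gauges\<close>

lemma gauge_fun_nonneg: "0 \<le> gauge_fun C u"
  unfolding gauge_fun_def by (intro INF_greatest) auto

lemma gauge_fun_le:
  assumes "c \<in> C" "0 < l"
  shows "gauge_fun C (l *\<^sub>R c) \<le> ereal l"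
  unfolding gauge_fun_def using assms by (intro INF_lower) auto

text \<open>The infimum need not be attained, but every scale strictly above it works: an admissible
scale \<open>l < r\<close> can be enlarged to \<open>r\<close>, since \<open>C\<close> is star-shaped around \<open>0\<close>.\<close>

lemma gauge_fun_lessD:
  assumes "convex C" "0 \<in> C" "gauge_fun C u < ereal r"
  obtains c where "c \<in> C" "u = r *\<^sub>R c" "0 < r"
proof -
  from assms(3) obtain l c where l: "0 < l" "l < r" "c \<in> C" "u = l *\<^sub>R c"
    unfolding gauge_fun_def by (auto simp: INF_less_iff)
  have "(l / r) *\<^sub>R c + (1 - l / r) *\<^sub>R 0 \<in> C"
    using l assms by (intro convexD) auto
  moreover have "u = r *\<^sub>R ((l / r) *\<^sub>R c)"
    using l by simp
  ultimately show ?thesis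
    using that[of "(l / r) *\<^sub>R c"] l by auto
qed

text \<open>Gauges are compared through their strict upper bounds, for which \<open>gauge_fun_lessD\<close>
supplies witnesses.\<close>

lemma ereal_le_via_reals:
  fixes a b :: ereal
  assumes "\<And>r. a < ereal r \<Longrightarrow> b \<le> ereal r"
  shows "b \<le> a"
  using assms ereal_dense2 leD not_le_imp_less by metis

text \<open>This covers \<open>a = 0\<close> too: division by \<open>0\<close> multiplies by \<open>\<infinity>\<close>, and \<open>0 * \<infinity> = 0\<close>, so both
sides then say \<open>b = 0\<close>.\<close>

lemma ereal_relative_increase_le_iff:
  fixes a b :: ereal and c :: real
  assumes "0 \<le> a" "a < \<infinity>" "0 \<le> b" "0 \<le> c"
  shows "(b - a) / a \<le> ereal c \<longleftrightarrow> b \<le> ereal (1 + c) * a"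
proof (cases a)
  case (real r)
  show ?thesis
  proof (cases "r = 0")
    case True
    with real assms show ?thesis
      by (cases b) (auto simp: divide_ereal_def zero_ereal_def[symmetric])
  next
    case False
    with real assms have "0 < r" by simp
    with real assms show ?thesis
      by (cases b) (auto simp: divide_ereal_def field_simps)
  qed
qed (use assms in auto)

lemma gauge_fun_antimono: "C \<subseteq> D \<Longrightarrow> gauge_fun D u \<le> gauge_fun C u"
  unfolding gauge_fun_def by (intro INF_superset_mono) auto

lemma gauge_fun_zero:
  assumes "0 \<in> C" shows "gauge_fun C 0 = 0"
proof (rule antisym)
  show "gauge_fun C 0 \<le> 0"
  proof (rule ereal_le_via_reals)
    fix r assume "(0::ereal) < ereal r"
    then show "gauge_fun C 0 \<le> ereal r"
      using gauge_fun_le[OF assms, of r] by simp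
  qed
qed (rule gauge_fun_nonneg)

lemma gauge_fun_scale_le:
  assumes "convex C" "0 \<in> C" "0 < k"
  shows "gauge_fun C (k *\<^sub>R u) \<le> ereal k * gauge_fun C u"
proof (rule ereal_le_via_reals)
  fix r assume "ereal k * gauge_fun C u < ereal r"
  then have "gauge_fun C u < ereal (r / k)"
    using \<open>0 < k\<close> by (cases "gauge_fun C u") (auto simp: field_simps)
  from gauge_fun_lessD[OF assms(1,2) this] obtain c
    where c: "c \<in> C" "u = (r / k) *\<^sub>R c" "0 < r / k" by blast
  then have "k *\<^sub>R u = r *\<^sub>R c" "0 < r" using \<open>0 < k\<close> by (auto simp: zero_less_divide_iff)
  then show "gauge_fun C (k *\<^sub>R u) \<le> ereal r"
    using gauge_fun_le[OF c(1)] by simp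
qed

lemma gauge_fun_scale:
  assumes "convex C" "0 \<in> C" "0 < k"
  shows "gauge_fun C (k *\<^sub>R u) = ereal k * gauge_fun C u"
proof (rule antisym[OF gauge_fun_scale_le[OF assms]])
  have "gauge_fun C u \<le> ereal (1 / k) * gauge_fun C (k *\<^sub>R u)"
    using gauge_fun_scale_le[OF assms(1,2), of "1 / k" "k *\<^sub>R u"] assms(3) by simp
  then have "ereal k * gauge_fun C u \<le> ereal k * (ereal (1 / k) * gauge_fun C (k *\<^sub>R u))"
    using assms(3) by (intro ereal_mult_left_mono) auto
  also have "\<dots> = gauge_fun C (k *\<^sub>R u)"
    using assms(3) by (cases "gauge_fun C (k *\<^sub>R u)") auto
  finally show "ereal k * gauge_fun C u \<le> gauge_fun C (k *\<^sub>R u)" .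
qed

lemma gauge_fun_triangle:
  assumes "convex C" "0 \<in> C"
  shows "gauge_fun C (u + v) \<le> gauge_fun C u + gauge_fun C v"
proof (rule ereal_le_via_reals)
  fix t assume t: "gauge_fun C u + gauge_fun C v < ereal t"
  obtain r s where rs: "gauge_fun C u < ereal r" "gauge_fun C v < ereal s" "r + s = t"
  proof -
    obtain a where a: "gauge_fun C u = ereal a"
      using t gauge_fun_nonneg[of C u] gauge_fun_nonneg[of C v]
      by (cases "gauge_fun C u"; cases "gauge_fun C v") auto
    obtain b where b: "gauge_fun C v = ereal b"
      using t gauge_fun_nonneg[of C u] gauge_fun_nonneg[of C v]
      by (cases "gauge_fun C u"; cases "gauge_fun C v") auto
    define d where "d = t - a - b"
    have "0 < d" using t by (simp add: d_def a b)
    then show ?thesis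
      using that[of "a + d / 2" "b + d / 2"] by (simp add: a b d_def field_simps)
  qed
  obtain c where c: "c \<in> C" "u = r *\<^sub>R c" "0 < r"
    using gauge_fun_lessD[OF assms rs(1)] by blast
  obtain d where d: "d \<in> C" "v = s *\<^sub>R d" "0 < s"
    using gauge_fun_lessD[OF assms rs(2)] by blast
  have "(r / t) *\<^sub>R c + (s / t) *\<^sub>R d \<in> C"
    using assms c d rs(3) by (intro convexD) (auto simp flip: add_divide_distrib)
  moreover have "u + v = t *\<^sub>R ((r / t) *\<^sub>R c + (s / t) *\<^sub>R d)"
    using c d rs(3) by (auto simp: scaleR_add_right)
  ultimately show "gauge_fun C (u + v) \<le> ereal t"
    using gauge_fun_le[of _ C t] c d rs(3) by auto
qed

text \<open>The two gauges can be witnessed at a common scale \<open>r\<close>, and then by the same vector, namely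
\<open>u\<close> divided by \<open>r\<close>.\<close>

lemma gauge_fun_Int:
  assumes "convex C" "0 \<in> C" "convex D" "0 \<in> D"
  shows "gauge_fun (C \<inter> D) u = max (gauge_fun C u) (gauge_fun D u)"
proof (rule antisym)
  show "gauge_fun (C \<inter> D) u \<le> max (gauge_fun C u) (gauge_fun D u)"
  proof (rule ereal_le_via_reals)
    fix r assume "max (gauge_fun C u) (gauge_fun D u) < ereal r"
    then have *: "gauge_fun C u < ereal r" "gauge_fun D u < ereal r" by auto
    obtain c where c: "c \<in> C" "u = r *\<^sub>R c" "0 < r"
      using gauge_fun_lessD[OF assms(1,2) *(1)] by blast
    obtain d where d: "d \<in> D" "u = r *\<^sub>R d"
      using gauge_fun_lessD[OF assms(3,4) *(2)] by blast
    with c have "c \<in> C \<inter> D" by auto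
    then show "gauge_fun (C \<inter> D) u \<le> ereal r"
      using gauge_fun_le[of c "C \<inter> D" r] c by auto
  qed
qed (simp add: gauge_fun_antimono)

lemma is_gaugeE:
  assumes "is_gauge \<Gamma>"
  obtains C where "closed C" "convex C" "0 \<in> C" "\<Gamma> = gauge_fun C"
  using assms unfolding is_gauge_def by blast

lemma gauge_fun_sum_le:
  assumes "convex C" "0 \<in> C" "finite B"
  shows "gauge_fun C (\<Sum>b\<in>B. g b) \<le> (\<Sum>b\<in>B. gauge_fun C (g b))"
  using assms(3)
proof induction
  case empty
  then show ?case using gauge_fun_zero[OF assms(2)] by simp
next
  case (insert b B)
  then show ?case
    using gauge_fun_triangle[OF assms(1,2), of "g b" "sum g B"]
    by simp (meson add_left_mono order_trans)
qed

lemma gauge_fun_scale_abs_le: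
  assumes "convex C" "0 \<in> C"
  shows "gauge_fun C (k *\<^sub>R u) \<le> ereal \<bar>k\<bar> * (gauge_fun C u + gauge_fun C (- u))"
proof -
  consider "k = 0" | "0 < k" | "k < 0" by linarith
  then show ?thesis
  proof cases
    case 1
    then show ?thesis by (simp add: gauge_fun_zero assms flip: zero_ereal_def)
  next
    case 2
    then show ?thesis
      using gauge_fun_scale[OF assms 2, of u] gauge_fun_nonneg[of C "-u"]
      by (auto intro!: ereal_mult_left_mono add_increasing2)
  next
    case 3
    have "gauge_fun C (k *\<^sub>R u) = ereal (- k) * gauge_fun C (- u)"
      using gauge_fun_scale[OF assms, of "- k" "-u"] 3 by simp
    then show ?thesis
      using 3 gauge_fun_nonneg[of C "u"]
      by (auto intro!: ereal_mult_left_mono add_increasing)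
  qed
qed

text \<open>Expand \<open>v\<close> in an orthonormal basis of \<open>V\<close> and use sublinearity. A gauge is only positively
homogeneous, so each basis vector contributes its value in both directions.\<close>

lemma gauge_fun_bounded_on_subspace:
  fixes V :: "'a::euclidean_space set"
  assumes "convex C" "0 \<in> C" "subspace V" "finite_on (gauge_fun C) V"
  obtains K where "0 \<le> K" "\<And>v. v \<in> V \<Longrightarrow> gauge_fun C v \<le> ereal (K * norm v)"
proof -
  obtain B where B: "B \<subseteq> V" "pairwise orthogonal B" "\<And>x. x \<in> B \<Longrightarrow> norm x = 1"
    "independent B" "span B = V"
    using orthonormal_basis_subspace[OF assms(3)] by metis
  have fin: "finite B" using B(4) by (simp add: independent_imp_finite)
  define k where "k b = gauge_fun C b + gauge_fun C (- b)" for b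
  have kfin: "\<exists>r. k b = ereal r \<and> 0 \<le> r" if "b \<in> B" for b
  proof -
    have "b \<in> V" "- b \<in> V" using that B(1) assms(3) by (auto simp: subspace_neg)
    then have "gauge_fun C b < \<infinity>" "gauge_fun C (- b) < \<infinity>"
      using assms(4) by (auto simp: finite_on_def)
    then show ?thesis
      unfolding k_def using gauge_fun_nonneg[of C b] gauge_fun_nonneg[of C "-b"]
      by (cases "gauge_fun C b"; cases "gauge_fun C (- b)") auto
  qed
  then obtain r where r: "\<And>b. b \<in> B \<Longrightarrow> k b = ereal (r b)" "\<And>b. b \<in> B \<Longrightarrow> 0 \<le> r b"
    by metis
  have "gauge_fun C v \<le> ereal ((\<Sum>b\<in>B. r b) * norm v)" if "v \<in> V" for v
  proof -
    have "v = (\<Sum>b\<in>B. (v \<bullet> b) *\<^sub>R b)"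
    proof -
      have "v \<in> span B" using that B(5) by simp
      then obtain u where u: "v = (\<Sum>b\<in>B. u b *\<^sub>R b)"
        using span_finite[OF fin] by auto
      have "v \<bullet> b = u b" if "b \<in> B" for b
      proof -
        have "v \<bullet> b = (\<Sum>c\<in>B. if c = b then u b else 0)"
          unfolding u inner_sum_left
        proof (rule sum.cong)
          fix c assume "c \<in> B"
          then show "(u c *\<^sub>R c) \<bullet> b = (if c = b then u b else 0)"
            using B(2) B(3)[OF that] that
            by (auto simp: pairwise_def orthogonal_def norm_eq_1)
        qed simp
        then show ?thesis using that fin by simp
      qed
      then show ?thesis using u by simp
    qed
    then have "gauge_fun C v \<le> (\<Sum>b\<in>B. gauge_fun C ((v \<bullet> b) *\<^sub>R b))"
      using gauge_fun_sum_le[OF assms(1,2) fin, of "\<lambda>b. (v \<bullet> b) *\<^sub>R b"] by simp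
    also have "\<dots> \<le> (\<Sum>b\<in>B. ereal (r b * norm v))"
    proof (rule sum_mono)
      fix b assume b: "b \<in> B"
      have "gauge_fun C ((v \<bullet> b) *\<^sub>R b) \<le> ereal \<bar>v \<bullet> b\<bar> * k b"
        unfolding k_def by (rule gauge_fun_scale_abs_le[OF assms(1,2)])
      also have "\<dots> = ereal (\<bar>v \<bullet> b\<bar> * r b)" using r b by simp
      also have "\<dots> \<le> ereal (r b * norm v)"
        using mult_left_mono[OF _ r(2)[OF b], of "\<bar>v \<bullet> b\<bar>" "norm v"]
          Cauchy_Schwarz_ineq2[of v b] B(3)[OF b] by (simp add: mult.commute)
      finally show "gauge_fun C ((v \<bullet> b) *\<^sub>R b) \<le> ereal (r b * norm v)" .
    qed
    also have "\<dots> = ereal ((\<Sum>b\<in>B. r b) * norm v)"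
      by (simp add: sum_distrib_right)
    finally show ?thesis .
  qed
  moreover have "0 \<le> (\<Sum>b\<in>B. r b)" using r(2) by (rule sum_nonneg)
  ultimately show ?thesis using that by blast
qed

lemma coercive_onD:
  assumes "coercive_on \<Gamma> V"
  obtains R where "\<And>v. v \<in> V \<Longrightarrow> \<Gamma> v \<le> ereal c \<Longrightarrow> norm v < R"
proof -
  have "eventually (\<lambda>v. ereal c < \<Gamma> v) (inf at_infinity (principal V))"
    using assms unfolding coercive_on_def by (rule order_tendstoD) simp
  then obtain R where "\<And>v. v \<in> V \<Longrightarrow> R \<le> norm v \<Longrightarrow> ereal c < \<Gamma> v"
    unfolding eventually_inf_principal eventually_at_infinity by blast
  then show ?thesis using that by (meson not_le)
qed

lemma coercive_on_mono:
  assumes "coercive_on \<Gamma> V" "W \<subseteq> V" "\<And>v. \<Gamma> v \<le> \<Gamma>' v"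
  shows "coercive_on \<Gamma>' W"
  unfolding coercive_on_def tendsto_PInfty eventually_inf_principal
proof
  fix r
  have "eventually (\<lambda>v. v \<in> V \<longrightarrow> ereal r < \<Gamma> v) at_infinity"
    using assms(1) by (simp add: coercive_on_def tendsto_PInfty eventually_inf_principal)
  then show "eventually (\<lambda>v. v \<in> W \<longrightarrow> ereal r < \<Gamma>' v) at_infinity"
    by (rule eventually_mono) (use assms(2,3) in \<open>auto intro: less_le_trans\<close>)
qed

text \<open>A gauge that vanishes at \<open>v\<close> vanishes on the whole ray through \<open>v\<close>, and coercivity bounds
the norms on this ray.\<close>

lemma gauge_fun_eq_zero_coercive:
  assumes "convex C" "0 \<in> C" "subspace V" "coercive_on (gauge_fun C) V" "v \<in> V" "gauge_fun C v = 0"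
  shows "v = 0"
proof (rule ccontr)
  assume "v \<noteq> 0"
  obtain R where R: "\<And>v. v \<in> V \<Longrightarrow> gauge_fun C v \<le> ereal 0 \<Longrightarrow> norm v < R"
    using coercive_onD[OF assms(4)] by blast
  have "R > 0" using R[of v] assms(5,6) norm_ge_zero[of v] by (simp del: norm_ge_zero)
  define k where "k = R / norm v"
  have "0 < k" using \<open>R > 0\<close> \<open>v \<noteq> 0\<close> by (simp add: k_def)
  have "gauge_fun C (k *\<^sub>R v) \<le> ereal 0"
    using gauge_fun_scale[OF assms(1,2) \<open>0 < k\<close>, of v] assms(6) by simp
  then have "norm (k *\<^sub>R v) < R"
    using R[of "k *\<^sub>R v"] assms(3,5) by (auto simp: subspace_scale)
  then show False using \<open>v \<noteq> 0\<close> \<open>R > 0\<close> by (simp add: k_def)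
qed

section \<open>Operator bounds\<close>

lemma op_bound_nonneg:
  assumes "0 \<in> V1" "\<Gamma>1 0 = 0" "\<And>w. 0 \<le> \<Gamma>2 w"
  shows "0 \<le> op_bound V1 \<Gamma>1 \<Gamma>2 A"
  unfolding op_bound_def using assms
  by (intro SUP_upper2[of 0]) auto

text \<open>Coercivity of \<open>\<Gamma>1\<close> makes the index set of the supremum bounded, and on bounded sets the
target gauge is bounded.\<close>

lemma op_bound_finite:
  assumes "coercive_on \<Gamma>1 V1"
    and "convex C" "0 \<in> C" "subspace V2" "finite_on (gauge_fun C) V2"
    and "\<And>v. v \<in> V1 \<Longrightarrow> A v \<in> V2" "\<And>v. v \<in> V1 \<Longrightarrow> norm (A v) \<le> norm v"
  shows "op_bound V1 \<Gamma>1 (gauge_fun C) A < \<infinity>"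
proof -
  obtain R where R: "\<And>v. v \<in> V1 \<Longrightarrow> \<Gamma>1 v \<le> ereal 1 \<Longrightarrow> norm v < R"
    using coercive_onD[OF assms(1)] by blast
  obtain K where K: "0 \<le> K" "\<And>v. v \<in> V2 \<Longrightarrow> gauge_fun C v \<le> ereal (K * norm v)"
    using gauge_fun_bounded_on_subspace[OF assms(2-5)] by blast
  have "op_bound V1 \<Gamma>1 (gauge_fun C) A \<le> ereal (K * R)"
    unfolding op_bound_def
  proof (rule SUP_least)
    fix v assume v: "v \<in> {v \<in> V1. \<Gamma>1 v \<le> 1}"
    then have "norm v < R" using R[of v] by (simp add: one_ereal_def)
    then have "norm (A v) \<le> R" using assms(7)[of v] v by auto
    then have "K * norm (A v) \<le> K * R" using K(1) by (rule mult_left_mono)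
    then show "gauge_fun C (A v) \<le> ereal (K * R)"
      using K(2)[of "A v"] assms(6)[of v] v by (auto intro: order_trans)
  qed
  then show ?thesis by (auto simp: less_top[symmetric] top_ereal_def)
qed

text \<open>Normalise \<open>v\<close> by its gauge; coercivity takes care of the vectors of gauge \<open>0\<close>.\<close>

lemma op_bound_apply:
  assumes "convex D" "0 \<in> D" "subspace V" "finite_on (gauge_fun D) V" "coercive_on (gauge_fun D) V"
    and "convex C" "0 \<in> C" "linear A" "v \<in> V"
  shows "gauge_fun C (A v) \<le> op_bound V (gauge_fun D) (gauge_fun C) A * gauge_fun D v"
proof (cases "gauge_fun D v = 0")
  case True
  then have "v = 0" using gauge_fun_eq_zero_coercive assms by blast
  then show ?thesis using assms by (simp add: gauge_fun_zero linear_0)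
next
  case False
  obtain r where r: "gauge_fun D v = ereal r" "0 < r"
    using False gauge_fun_nonneg[of D v] assms(4,9)
    by (cases "gauge_fun D v") (auto simp: finite_on_def)
  define w where "w = (1 / r) *\<^sub>R v"
  have "w \<in> V" using assms(3,9) by (simp add: w_def subspace_scale)
  moreover have "gauge_fun D w \<le> 1"
    using gauge_fun_scale[OF assms(1,2), of "1 / r" v] r by (simp add: w_def one_ereal_def)
  ultimately have "gauge_fun C (A w) \<le> op_bound V (gauge_fun D) (gauge_fun C) A"
    unfolding op_bound_def by (intro SUP_upper) auto
  moreover have "gauge_fun C (A v) = ereal r * gauge_fun C (A w)"
    using gauge_fun_scale[OF assms(6,7), of r "A w"] r assms(8) by (simp add: w_def linear_scale)
  ultimately show ?thesis
    using r by (simp add: ereal_mult_left_mono mult.commute[of _ "ereal r"])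
qed

section \<open>Orthogonal projections onto subspaces\<close>

lemma orthogonal_comp_iff: "x \<in> W\<^sup>\<bottom> \<longleftrightarrow> (\<forall>y\<in>W. y \<bullet> x = 0)"
  by (simp add: orthogonal_comp_def orthogonal_def)

lemma closest_point_affine_eqI:
  fixes S :: "'a::euclidean_space set"
  assumes "affine S" "y \<in> S" "\<And>z. z \<in> S \<Longrightarrow> (a - y) \<bullet> (z - y) = 0"
  shows "closest_point S a = y"
proof -
  have "dist a y \<le> dist a z" if "z \<in> S" for z
  proof -
    have "(norm (a - z))\<^sup>2 = (norm (a - y))\<^sup>2 + (norm (z - y))\<^sup>2"
      using norm_add_Pythagorean[of "a - y" "y - z"] assms(3)[OF that]
      by (simp add: orthogonal_def norm_minus_commute inner_diff_right)
    then have "(norm (a - y))\<^sup>2 \<le> (norm (a - z))\<^sup>2"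
      by (metis le_add_same_cancel1 zero_le_power2)
    then show ?thesis
      unfolding dist_norm by (rule power2_le_imp_le) (rule norm_ge_zero)
  qed
  then show ?thesis
    using closest_point_unique[of S y a] assms
    by (simp add: affine_imp_convex affine_closed)
qed

lemma closest_point_subspace_eqI:
  fixes V :: "'a::euclidean_space set"
  assumes "subspace V" "y \<in> V" "\<And>z. z \<in> V \<Longrightarrow> (a - y) \<bullet> z = 0"
  shows "closest_point V a = y"
  using assms by (intro closest_point_affine_eqI) (auto simp: subspace_imp_affine subspace_diff)

lemma closest_point_affine_orthogonal:
  fixes S :: "'a::euclidean_space set"
  assumes "affine S" "w \<in> S" "z \<in> S"
  shows "(a - closest_point S a) \<bullet> (z - w) = 0"
proof -
  define y where "y = closest_point S a"
  have conv: "convex S" "closed S" "S \<noteq> {}"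
    using assms by (auto simp: affine_imp_convex affine_closed)
  have "y \<in> S" unfolding y_def using conv by (simp add: closest_point_in_set)
  have *: "(a - y) \<bullet> (u - y) = 0" if "u \<in> S" for u
  proof -
    \<comment> \<open>Reflecting \<open>u\<close> through \<open>y\<close> turns the variational inequality into an equality.\<close>
    have "y + y - u \<in> S"
      using mem_affine_3_minus[OF assms(1) \<open>y \<in> S\<close> \<open>y \<in> S\<close> that, of 1] by (simp add: add_diff_eq)
    then show ?thesis
      using closest_point_dot[OF conv(1,2), of "y + y - u" a] closest_point_dot[OF conv(1,2) that, of a]
      by (simp add: y_def[symmetric] inner_diff_right inner_add_right)
  qed
  show ?thesis
    using *[OF assms(2)] *[OF assms(3)] by (simp add: y_def inner_diff_right)
qed

context
  fixes V :: "'a::euclidean_space set"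
  assumes V: "subspace V"
begin

lemma closest_point_subspace_in: "closest_point V a \<in> V"
  using V subspace_0[OF V] closest_point_in_set closed_subspace by blast

lemma closest_point_subspace_orthogonal: "z \<in> V \<Longrightarrow> (a - closest_point V a) \<bullet> z = 0"
  using closest_point_affine_orthogonal[of V 0 z a] V
  by (simp add: subspace_0 subspace_imp_affine)

lemma closest_point_subspace_linear: "linear (closest_point V)"
proof
  fix a b :: 'a and c :: real
  show "closest_point V (a + b) = closest_point V a + closest_point V b"
  proof (rule closest_point_subspace_eqI[OF V])
    fix z assume "z \<in> V"
    then show "(a + b - (closest_point V a + closest_point V b)) \<bullet> z = 0"
      using closest_point_subspace_orthogonal[of z a] closest_point_subspace_orthogonal[of z b]
      by (simp add: inner_diff_left inner_add_left)
  qed (simp add: closest_point_subspace_in subspace_add V)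
  show "closest_point V (c *\<^sub>R a) = c *\<^sub>R closest_point V a"
  proof (rule closest_point_subspace_eqI[OF V])
    fix z assume "z \<in> V"
    then show "(c *\<^sub>R a - c *\<^sub>R closest_point V a) \<bullet> z = 0"
      using closest_point_subspace_orthogonal[of z a] by (simp flip: scaleR_diff_right)
  qed (simp add: closest_point_subspace_in subspace_scale V)
qed

lemma norm_closest_point_subspace_le: "norm (closest_point V a) \<le> norm a"
proof -
  have "orthogonal (a - closest_point V a) (closest_point V a)"
    by (simp add: orthogonal_def closest_point_subspace_orthogonal closest_point_subspace_in)
  from norm_add_Pythagorean[OF this]
  have "(norm (closest_point V a))\<^sup>2 \<le> (norm a)\<^sup>2" by simp
  then show ?thesis by (rule power2_le_imp_le) simp
qed

lemma closest_point_orthogonal_comp: "closest_point (V\<^sup>\<bottom>) a = a - closest_point V a"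
proof (rule closest_point_subspace_eqI[OF subspace_orthogonal_comp])
  show "a - closest_point V a \<in> V\<^sup>\<bottom>"
    using closest_point_subspace_orthogonal[of _ a]
    by (auto simp: orthogonal_comp_iff inner_commute)
qed (auto simp: orthogonal_comp_iff closest_point_subspace_in)

end

lemma closest_point_subspace_id: "subspace V \<Longrightarrow> v \<in> V \<Longrightarrow> closest_point V v = v"
  for V :: "'a::euclidean_space set"
  by (simp add: closest_point_subspace_eqI)

lemma closest_point_comp_subset:
  fixes V :: "'a::euclidean_space set"
  assumes "subspace V" "subspace W" "W \<subseteq> V"
  shows "closest_point W (closest_point V a) = closest_point W a"
proof (rule closest_point_subspace_eqI[OF assms(2) closest_point_subspace_in[OF assms(2)]])
  fix z assume z: "z \<in> W"
  then have "(a - closest_point W a) \<bullet> z = 0" "(a - closest_point V a) \<bullet> z = 0"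
    using closest_point_subspace_orthogonal assms by blast+
  then show "(closest_point V a - closest_point W a) \<bullet> z = 0"
    by (simp add: inner_diff_left)
qed

text \<open>The component of \<open>d\<close> in \<open>T\<^sup>\<bottom>\<close> already lies in \<open>S\<close>. On \<open>T\<close> the projection onto \<open>S\<close> agrees
with the projection onto \<open>S \<inter> T\<close>, because \<open>S\<close> is the orthogonal sum of \<open>T\<^sup>\<bottom>\<close> and \<open>S \<inter> T\<close>.\<close>

lemma closest_point_orthogonal_split:
  fixes T :: "'a::euclidean_space set"
  assumes T: "subspace T" and S: "subspace S" and sub: "T\<^sup>\<bottom> \<subseteq> S"
  shows "closest_point S d = closest_point (T\<^sup>\<bottom>) d + closest_point (S \<inter> T) (closest_point T d)"
proof (rule closest_point_subspace_eqI[OF S])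
  have ST: "subspace (S \<inter> T)" using S T by (rule subspace_inter)
  define t where "t = closest_point T d"
  define r where "r = t - closest_point (S \<inter> T) t"
  have tT: "closest_point (T\<^sup>\<bottom>) d \<in> T\<^sup>\<bottom>" for d
    by (rule closest_point_subspace_in[OF subspace_orthogonal_comp])
  have inST: "closest_point (S \<inter> T) t \<in> S \<inter> T" by (rule closest_point_subspace_in[OF ST])
  show "closest_point (T\<^sup>\<bottom>) d + closest_point (S \<inter> T) (closest_point T d) \<in> S"
    using tT inST sub S by (auto simp: t_def intro!: subspace_add)
  fix z assume z: "z \<in> S"
  have "r \<in> T"
    using T inST closest_point_subspace_in[OF T, of d] by (auto simp: r_def t_def intro!: subspace_diff)
  have z_dec: "z = closest_point (T\<^sup>\<bottom>) z + closest_point T z"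
    using closest_point_orthogonal_comp[OF T, of z] by simp
  have "closest_point T z = z - closest_point (T\<^sup>\<bottom>) z" using z_dec by (simp add: algebra_simps)
  then have "closest_point T z \<in> S \<inter> T"
    using closest_point_subspace_in[OF T, of z] z tT[of z] sub S by (auto intro!: subspace_diff)
  then have "r \<bullet> closest_point T z = 0"
    unfolding r_def by (rule closest_point_subspace_orthogonal[OF ST])
  moreover have "r \<bullet> closest_point (T\<^sup>\<bottom>) z = 0"
    using \<open>r \<in> T\<close> tT[of z] by (simp add: orthogonal_comp_iff)
  ultimately have "r \<bullet> z = 0" by (subst z_dec) (simp add: inner_add_right)
  moreover have "d - (closest_point (T\<^sup>\<bottom>) d + closest_point (S \<inter> T) (closest_point T d)) = r"
    using closest_point_orthogonal_comp[OF T, of d] by (simp add: r_def t_def)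
  ultimately show
    "(d - (closest_point (T\<^sup>\<bottom>) d + closest_point (S \<inter> T) (closest_point T d))) \<bullet> z = 0" by simp
qed

section \<open>Subdifferentials of finite convex functions\<close>

text \<open>Separate the strict epigraph of \<open>f\<close> from the hypograph of \<open>g\<close>. The hyperplane cannot be
vertical because \<open>f\<close> is finite on the whole space, so it is the graph of an affine function.
Taking \<open>S\<close> a single point yields subgradients, and \<open>S\<close> the whole space the sum rule.\<close>

lemma convex_concave_sandwich:
  fixes f :: "'a::euclidean_space \<Rightarrow> real"
  assumes f: "convex_on UNIV f" and g: "concave_on S g" and ne: "y0 \<in> S"
    and le: "\<And>y. y \<in> S \<Longrightarrow> g y \<le> f y"
  shows "\<exists>p c. (\<forall>y. p \<bullet> y + c \<le> f y) \<and> (\<forall>y\<in>S. g y \<le> p \<bullet> y + c)"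
proof -
  define A where "A = {(y, t). y \<in> S \<and> t \<le> g y}"
  define B where "B = {(y, t). f y < t}"
  have "convex S" using g by (simp add: concave_on_def convex_on_imp_convex)
  have "convex A"
  proof (rule convexI)
    fix z w and u v :: real
    assume *: "z \<in> A" "w \<in> A" "0 \<le> u" "0 \<le> v" "u + v = 1"
    obtain a s b t where zw: "z = (a, s)" "w = (b, t)" by (metis prod.exhaust)
    have "u * s + v * t \<le> u * g a + v * g b"
      using * zw by (intro add_mono mult_left_mono) (auto simp: A_def)
    also have "\<dots> \<le> g (u *\<^sub>R a + v *\<^sub>R b)"
      using g * zw by (simp add: concave_on_iff A_def)
    finally show "u *\<^sub>R z + v *\<^sub>R w \<in> A"
      using * zw \<open>convex S\<close> by (auto simp: A_def intro: convexD)
  qed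
  moreover have "convex B"
  proof (rule convexI)
    fix z w and u v :: real
    assume *: "z \<in> B" "w \<in> B" "0 \<le> u" "0 \<le> v" "u + v = 1"
    obtain a s b t where zw: "z = (a, s)" "w = (b, t)" by (metis prod.exhaust)
    have fa: "f a < s" "f b < t" using * zw by (auto simp: B_def)
    have "f (u *\<^sub>R a + v *\<^sub>R b) \<le> u * f a + v * f b"
      using f * by (simp add: convex_on_def)
    also have "\<dots> < u * s + v * t"
    proof (cases "u = 0")
      case True then show ?thesis using fa * by simp
    next
      case False
      then have "u * f a < u * s" using fa * by simp
      moreover have "v * f b \<le> v * t" using fa * by (simp add: mult_left_mono)
      ultimately show ?thesis by linarith
    qed
    finally show "u *\<^sub>R z + v *\<^sub>R w \<in> B" by (simp add: zw B_def)
  qed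
  moreover have "A \<noteq> {}" using ne by (auto simp: A_def)
  moreover have "(0, f 0 + 1) \<in> B" by (simp add: B_def)
  then have "B \<noteq> {}" by blast
  moreover have "A \<inter> B = {}" using le by (force simp: A_def B_def)
  ultimately obtain q b where q: "q \<noteq> 0" "\<And>z. z \<in> A \<Longrightarrow> q \<bullet> z \<le> b" "\<And>z. z \<in> B \<Longrightarrow> b \<le> q \<bullet> z"
    using separating_hyperplane_sets[of A B] by blast
  obtain p s where ps: "q = (p, s)" by (metis prod.exhaust)
  have below: "p \<bullet> y + s * t \<le> b" if "y \<in> S" "t \<le> g y" for y t
    using q(2)[of "(y, t)"] that by (simp add: A_def ps)
  have above: "b \<le> p \<bullet> y + s * t" if "f y < t" for y t
    using q(3)[of "(y, t)"] that by (simp add: B_def ps)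
  have "0 < s"
  proof (rule ccontr)
    assume "\<not> 0 < s"
    then consider "s = 0" | "s < 0" by linarith
    then show False
    proof cases
      case 1
      \<comment> \<open>A vertical hyperplane bounds \<open>p \<bullet> y\<close> from below on the whole space; test it by moving
        from \<open>y0\<close> against \<open>p\<close>.\<close>
      have "b \<le> p \<bullet> (y0 - p)" using above[of "y0 - p" "f (y0 - p) + 1"] 1 by simp
      moreover have "p \<bullet> y0 \<le> b" using below[OF ne order_refl] 1 by simp
      ultimately have "p \<bullet> p \<le> 0" by (simp add: inner_diff_right)
      then have "p = 0" by (metis inner_ge_zero inner_eq_zero_iff order_antisym)
      then show False using q(1) ps 1 by (simp add: zero_prod_def)
    next
      case 2
      have a: "b \<le> p \<bullet> y0 + s * (f y0 + 1)" by (rule above) simp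
      have "p \<bullet> y0 + s * (g y0) \<le> b" using below[OF ne order_refl] .
      moreover have "s * (f y0 + 1) < s * g y0"
        using 2 le[OF ne] by (intro mult_strict_left_mono_neg) auto
      ultimately show False using a by linarith
    qed
  qed
  show ?thesis
  proof (intro exI conjI allI ballI)
    fix y
    have "b \<le> p \<bullet> y + s * f y"
    proof (rule field_le_epsilon)
      fix e :: real assume "0 < e"
      then show "b \<le> p \<bullet> y + s * f y + e"
        using above[of y "f y + e / s"] \<open>0 < s\<close> by (simp add: distrib_left)
    qed
    then show "- (p /\<^sub>R s) \<bullet> y + b / s \<le> f y" using \<open>0 < s\<close> by (simp add: field_simps)
  next
    fix y assume "y \<in> S"
    then show "g y \<le> - (p /\<^sub>R s) \<bullet> y + b / s"
      using below[of y "g y"] \<open>0 < s\<close> by (simp add: field_simps)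
  qed
qed

lemma subdifferential_nonempty:
  fixes f :: "'a::euclidean_space \<Rightarrow> real"
  assumes "convex_on UNIV f"
  obtains p where "p \<in> subdifferential f x"
proof -
  have "concave_on {x} f" by (simp add: concave_on_iff flip: scaleR_add_left distrib_right)
  then obtain p c where pc: "\<And>y. p \<bullet> y + c \<le> f y" "f x \<le> p \<bullet> x + c"
    using convex_concave_sandwich[OF assms, of "{x}" f x] by auto
  have "f x + p \<bullet> (y - x) \<le> f y" for y using pc(1)[of y] pc(2) by (simp add: inner_diff_right)
  then have "p \<in> subdifferential f x" by (simp add: subdifferential_def)
  then show ?thesis by (rule that)
qed

text \<open>If \<open>u\<close> is a subgradient of the sum, then \<open>J\<close> lies above the concave function
\<open>y \<mapsto> J x + G x + u \<bullet> (y - x) - G y\<close> and touches it at \<open>x\<close>. The slope of an affine function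
between the two is a subgradient of \<open>J\<close>, and what is left of \<open>u\<close> is one of \<open>G\<close>.\<close>

lemma subdifferential_add:
  fixes J G :: "'a::euclidean_space \<Rightarrow> real"
  assumes J: "convex_on UNIV J" and G: "convex_on UNIV G"
  shows "subdifferential (\<lambda>z. J z + G z) x = subdifferential J x + subdifferential G x"
proof (intro subset_antisym subsetI)
  fix u assume "u \<in> subdifferential J x + subdifferential G x"
  then obtain a b where "u = a + b" "a \<in> subdifferential J x" "b \<in> subdifferential G x"
    by (auto elim: set_plus_elim)
  then show "u \<in> subdifferential (\<lambda>z. J z + G z) x"
    unfolding subdifferential_def by (force simp: inner_add_left intro: add_mono[THEN order_trans[rotated]])
next
  fix u assume u: "u \<in> subdifferential (\<lambda>z. J z + G z) x"
  define g where "g y = (u \<bullet> y + (J x + G x - u \<bullet> x)) - G y" for y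
  have "concave_on UNIV g"
  proof (unfold concave_on_iff, intro conjI ballI allI impI)
    fix a b and s t :: real
    assume st: "0 \<le> s" "0 \<le> t" "s + t = 1"
    have "G (s *\<^sub>R a + t *\<^sub>R b) \<le> s * G a + t * G b" using G st by (simp add: convex_on_def)
    moreover have "s * k + t * k = k" for k using st by (metis distrib_right mult_1)
    from this[of "J x + G x - u \<bullet> x"]
    have "s * g a + t * g b = u \<bullet> (s *\<^sub>R a + t *\<^sub>R b) + (J x + G x - u \<bullet> x) - (s * G a + t * G b)"
      by (simp add: g_def inner_add_right algebra_simps)
    ultimately show "s * g a + t * g b \<le> g (s *\<^sub>R a + t *\<^sub>R b)" by (simp add: g_def)
  qed simp
  moreover have "g y \<le> J y" for y
  proof -
    have "J x + G x + u \<bullet> (y - x) \<le> J y + G y" using u by (simp add: subdifferential_def)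
    then show ?thesis by (simp add: g_def inner_diff_right)
  qed
  ultimately obtain p c where pc: "\<And>y. p \<bullet> y + c \<le> J y" "\<And>y. g y \<le> p \<bullet> y + c"
    using convex_concave_sandwich[OF J, of UNIV g 0] by auto
  have c: "c = J x - p \<bullet> x" using pc(1)[of x] pc(2)[of x] by (simp add: g_def)
  have "p \<in> subdifferential J x"
    using pc(1) by (auto simp: subdifferential_def c inner_diff_right algebra_simps)
  moreover have "u - p \<in> subdifferential G x"
    using pc(2) by (auto simp: subdifferential_def c g_def inner_diff_right inner_diff_left algebra_simps)
  ultimately show "u \<in> subdifferential J x + subdifferential G x"
    using set_plus_intro[of p _ "u - p"] by force
qed

lemma convex_subdifferential: "convex (subdifferential J x)"
proof (rule convexI)
  fix a b and s t :: real
  assume *: "a \<in> subdifferential J x" "b \<in> subdifferential J x" "0 \<le> s" "0 \<le> t" "s + t = 1"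
  have "J x + (s *\<^sub>R a + t *\<^sub>R b) \<bullet> (y - x) \<le> J y" for y
  proof -
    have "s * (J x + a \<bullet> (y - x)) + t * (J x + b \<bullet> (y - x)) \<le> s * J y + t * J y"
      using * by (intro add_mono mult_left_mono) (auto simp: subdifferential_def)
    moreover have k: "s * k + t * k = k" for k using * by (metis distrib_right mult_1)
    ultimately show ?thesis
      using k[of "J x"] k[of "J y"] unfolding distrib_left inner_add_left inner_scaleR_left by linarith
  qed
  then show "s *\<^sub>R a + t *\<^sub>R b \<in> subdifferential J x" by (simp add: subdifferential_def)
qed

text \<open>Outer semicontinuity of the subdifferential, by passing to the limit in the subgradient
inequality; finite convex functions are continuous.\<close>

lemma subdifferential_closed_graph:
  fixes J :: "'a::euclidean_space \<Rightarrow> real"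
  assumes J: "convex_on UNIV J"
    and v: "\<And>k::nat. v k \<in> subdifferential J (y k)" and lim: "y \<longlonglongrightarrow> x" "v \<longlonglongrightarrow> u"
  shows "u \<in> subdifferential J x"
proof -
  have "isCont J x"
    using convex_on_continuous[OF open_UNIV J] by (simp add: continuous_on_eq_continuous_at)
  then have Jlim: "(\<lambda>k. J (y k)) \<longlonglongrightarrow> J x" using lim(1) isCont_tendsto_compose by blast
  have "J x + u \<bullet> (z - x) \<le> J z" for z
  proof (rule LIMSEQ_le_const2)
    show "(\<lambda>k. J (y k) + v k \<bullet> (z - y k)) \<longlonglongrightarrow> J x + u \<bullet> (z - x)"
      by (intro tendsto_intros Jlim lim)
    show "\<exists>N. \<forall>n\<ge>N. J (y n) + v n \<bullet> (z - y n) \<le> J z"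
      using v by (auto simp: subdifferential_def)
  qed
  then show ?thesis by (simp add: subdifferential_def)
qed

section \<open>Model subspaces\<close>

lemma subspace_model_T: "subspace (model_T J x)"
  unfolding model_T_def by (rule subspace_orthogonal_comp)

context
  fixes J :: "'a::euclidean_space \<Rightarrow> real" and x :: 'a
  assumes J: "convex_on UNIV J"
begin

lemma model_e_in_affine: "model_e J x \<in> model_affine J x"
proof -
  obtain p where "p \<in> subdifferential J x" using subdifferential_nonempty[OF J] .
  then show ?thesis
    unfolding model_e_def model_affine_def
    by (intro closest_point_in_set) (auto simp: affine_closed hull_inc)
qed

lemma subspace_model_S: "subspace (model_S J x)"
  unfolding model_S_def
  using model_e_in_affine by (intro affine_diffs_subspace_subtract) (simp_all add: model_affine_def)

lemma diff_model_e_in_model_S: "p \<in> subdifferential J x \<Longrightarrow> p - model_e J x \<in> model_S J x"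
  by (simp add: model_S_def model_affine_def hull_inc)

lemma model_e_in_model_T: "model_e J x \<in> model_T J x"
proof -
  have "(a - model_e J x) \<bullet> model_e J x = 0" if "a \<in> model_affine J x" for a
    using closest_point_affine_orthogonal[OF _ model_e_in_affine that, of 0]
    by (simp add: model_affine_def model_e_def inner_commute)
  then show ?thesis
    by (simp add: model_T_def orthogonal_comp_iff model_S_def)
qed

lemma orthogonal_comp_model_T: "(model_T J x)\<^sup>\<bottom> = model_S J x"
  unfolding model_T_def by (rule orthogonal_comp_self[OF subspace_model_S])

text \<open>This description of \<open>T\<close> avoids the affine hull, which makes it easy to use for Minkowski sums.\<close>

lemma model_T_iff:
  assumes p: "p \<in> subdifferential J x"
  shows "t \<in> model_T J x \<longleftrightarrow> (\<forall>u\<in>subdifferential J x. t \<bullet> u = t \<bullet> p)"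
proof
  assume t: "t \<in> model_T J x"
  have "t \<bullet> u = t \<bullet> model_e J x" if "u \<in> subdifferential J x" for u
  proof -
    have "(u - model_e J x) \<bullet> t = 0"
      using diff_model_e_in_model_S[OF that] t by (simp add: model_T_def orthogonal_comp_iff)
    then show ?thesis by (simp add: inner_diff_right inner_commute)
  qed
  then show "\<forall>u\<in>subdifferential J x. t \<bullet> u = t \<bullet> p" using p by simp
next
  assume "\<forall>u\<in>subdifferential J x. t \<bullet> u = t \<bullet> p"
  then have sub: "model_affine J x \<subseteq> {u. t \<bullet> u = t \<bullet> p}"
    unfolding model_affine_def by (intro hull_minimal) (auto simp: affine_hyperplane)
  have "t \<bullet> u = t \<bullet> model_e J x" if "u \<in> model_affine J x" for u
    using subsetD[OF sub that] subsetD[OF sub model_e_in_affine] by simp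
  then show "t \<in> model_T J x"
    by (auto simp: model_T_def orthogonal_comp_iff model_S_def inner_diff_right inner_commute[of _ t])
qed

lemma closest_point_model_T:
  assumes "p \<in> subdifferential J x"
  shows "closest_point (model_T J x) p = model_e J x"
proof (rule closest_point_subspace_eqI[OF subspace_model_T model_e_in_model_T])
  fix z assume "z \<in> model_T J x"
  then show "(p - model_e J x) \<bullet> z = 0"
    using diff_model_e_in_model_S[OF assms] by (simp add: model_T_def orthogonal_comp_iff)
qed

end

lemma model_T_add:
  fixes J G :: "'a::euclidean_space \<Rightarrow> real"
  assumes J: "convex_on UNIV J" and G: "convex_on UNIV G"
  shows "model_T (\<lambda>z. J z + G z) x = model_T J x \<inter> model_T G x"
proof -
  obtain p where p: "p \<in> subdifferential J x" using subdifferential_nonempty[OF J] .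
  obtain q where q: "q \<in> subdifferential G x" using subdifferential_nonempty[OF G] .
  have pq: "p + q \<in> subdifferential (\<lambda>z. J z + G z) x"
    unfolding subdifferential_add[OF J G] using p q by (rule set_plus_intro)
  show ?thesis
  proof (intro subset_antisym subsetI)
    fix t assume "t \<in> model_T (\<lambda>z. J z + G z) x"
    then have "t \<bullet> (u + v) = t \<bullet> (p + q)"
      if "u \<in> subdifferential J x" "v \<in> subdifferential G x" for u v
      using model_T_iff[OF convex_on_add[OF J G] pq] set_plus_intro[OF that]
      by (simp add: subdifferential_add[OF J G])
    from this[OF _ q] this[OF p]
    have "\<forall>u\<in>subdifferential J x. t \<bullet> u = t \<bullet> p" "\<forall>u\<in>subdifferential G x. t \<bullet> u = t \<bullet> q"
      by (simp_all add: inner_add_right)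
    then show "t \<in> model_T J x \<inter> model_T G x"
      by (simp add: model_T_iff[OF J p] model_T_iff[OF G q])
  next
    fix t assume "t \<in> model_T J x \<inter> model_T G x"
    then have "\<forall>u\<in>subdifferential J x. t \<bullet> u = t \<bullet> p" "\<forall>u\<in>subdifferential G x. t \<bullet> u = t \<bullet> q"
      by (simp_all add: model_T_iff[OF J p] model_T_iff[OF G q])
    then show "t \<in> model_T (\<lambda>z. J z + G z) x"
      unfolding model_T_iff[OF convex_on_add[OF J G] pq] subdifferential_add[OF J G]
      by (auto simp: inner_add_right elim!: set_plus_elim)
  qed
qed

text \<open>Any subgradients \<open>p\<close> of \<open>J\<close> and \<open>q\<close> of \<open>G\<close> project to \<open>e\<^sup>J\<close> and \<open>e\<^sup>G\<close>, and their sum projects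
to \<open>e\<^sup>H\<close>; projecting first onto the larger subspaces does not change the projection onto \<open>T\<close>.\<close>

lemma model_e_add:
  fixes J G :: "'a::euclidean_space \<Rightarrow> real" and x :: 'a
  assumes J: "convex_on UNIV J" and G: "convex_on UNIV G"
  defines "T \<equiv> model_T (\<lambda>z. J z + G z) x"
  shows "model_e (\<lambda>z. J z + G z) x = closest_point T (model_e J x) + closest_point T (model_e G x)"
proof -
  obtain p where p: "p \<in> subdifferential J x" using subdifferential_nonempty[OF J] .
  obtain q where q: "q \<in> subdifferential G x" using subdifferential_nonempty[OF G] .
  have pq: "p + q \<in> subdifferential (\<lambda>z. J z + G z) x"
    unfolding subdifferential_add[OF J G] using p q by (rule set_plus_intro)
  have T: "subspace T" "T \<subseteq> model_T J x" "T \<subseteq> model_T G x"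
    by (auto simp: T_def subspace_model_T subspace_inter model_T_add[OF J G])
  have "model_e (\<lambda>z. J z + G z) x = closest_point T (p + q)"
    unfolding T_def by (simp add: closest_point_model_T[OF convex_on_add[OF J G] pq])
  also have "\<dots> = closest_point T p + closest_point T q"
    by (rule linear_add[OF closest_point_subspace_linear[OF T(1)]])
  also have "closest_point T p = closest_point T (model_e J x)"
    using closest_point_comp_subset[OF subspace_model_T T(1,2), of p]
    by (simp add: closest_point_model_T[OF J p])
  also have "closest_point T q = closest_point T (model_e G x)"
    using closest_point_comp_subset[OF subspace_model_T T(1,3), of q]
    by (simp add: closest_point_model_T[OF G q])
  finally show ?thesis .
qed

section \<open>Subdifferential gauges\<close>

lemma convex_subdiff_translate: "convex ((\<lambda>u. u - p) ` subdifferential J x)"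
  by (rule convex_translation_subtract[OF convex_subdifferential])

lemma zero_in_subdiff_translate:
  "p \<in> subdifferential J x \<Longrightarrow> 0 \<in> (\<lambda>u. u - p) ` subdifferential J x"
  by force

lemma diff_subdifferential_in_model_S:
  assumes "convex_on UNIV J" "u \<in> subdifferential J x" "p \<in> subdifferential J x"
  shows "u - p \<in> model_S J x"
  using subspace_diff[OF subspace_model_S[OF assms(1)] diff_model_e_in_model_S[OF assms(1,2)]
      diff_model_e_in_model_S[OF assms(1,3)]] by simp

text \<open>Around a relative interior point \<open>p\<close>, a small multiple of every vector of \<open>S\<close> can be added
without leaving the subdifferential.\<close>

lemma subdiff_gauge_finite_on_model_S:
  fixes J :: "'a::euclidean_space \<Rightarrow> real"
  assumes J: "convex_on UNIV J" and p: "p \<in> rel_interior (subdifferential J x)"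
  shows "finite_on (subdiff_gauge J x p) (model_S J x)"
  unfolding finite_on_def
proof
  fix v assume v: "v \<in> model_S J x"
  obtain e where e: "p \<in> subdifferential J x" "0 < e"
    "ball p e \<inter> affine hull subdifferential J x \<subseteq> subdifferential J x"
    using p by (auto simp: mem_rel_interior_ball)
  define k where "k = e / (norm v + 1)"
  have nv: "0 < norm v + 1" using norm_ge_zero[of v] by linarith
  then have "0 < k" using e(2) by (simp add: k_def)
  have "norm (k *\<^sub>R v) < e"
    using e(2) nv by (simp add: k_def field_simps)
  moreover have "p + k *\<^sub>R v \<in> affine hull subdifferential J x"
  proof -
    have "(p - model_e J x) + k *\<^sub>R v \<in> model_S J x"
      using subspace_model_S[OF J] v diff_model_e_in_model_S[OF J e(1)]
      by (intro subspace_add subspace_scale)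
    then show ?thesis by (auto simp: model_S_def model_affine_def algebra_simps)
  qed
  ultimately have "p + k *\<^sub>R v \<in> subdifferential J x"
    using e(3) by (auto simp: dist_norm)
  then have "k *\<^sub>R v \<in> (\<lambda>u. u - p) ` subdifferential J x" by force
  from gauge_fun_le[OF this, of "1 / k"] \<open>0 < k\<close>
  have "subdiff_gauge J x p v \<le> ereal (1 / k)" by (simp add: subdiff_gauge_def)
  then show "subdiff_gauge J x p v < \<infinity>" by (rule le_less_trans) simp
qed

lemma subdiff_translate_add:
  fixes J G :: "'a::euclidean_space \<Rightarrow> real"
  assumes J: "convex_on UNIV J" and G: "convex_on UNIV G"
  shows "(\<lambda>u. u - (p + q)) ` subdifferential (\<lambda>z. J z + G z) x =
    (\<lambda>u. u - p) ` subdifferential J x + (\<lambda>u. u - q) ` subdifferential G x"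
  unfolding subdifferential_add[OF J G]
proof (intro subset_antisym subsetI)
  fix u assume "u \<in> (\<lambda>u. u - (p + q)) ` (subdifferential J x + subdifferential G x)"
  then obtain a b where "a \<in> subdifferential J x" "b \<in> subdifferential G x" "u = (a - p) + (b - q)"
    by (auto elim!: set_plus_elim)
  then show "u \<in> (\<lambda>u. u - p) ` subdifferential J x + (\<lambda>u. u - q) ` subdifferential G x"
    by (auto intro!: set_plus_intro)
next
  fix u assume "u \<in> (\<lambda>u. u - p) ` subdifferential J x + (\<lambda>u. u - q) ` subdifferential G x"
  then obtain a b where ab: "a \<in> subdifferential J x" "b \<in> subdifferential G x" "u = (a - p) + (b - q)"
    by (auto elim!: set_plus_elim)
  then have "a + b \<in> subdifferential J x + subdifferential G x" "u = (a + b) - (p + q)"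
    by (auto intro!: set_plus_intro)
  then show "u \<in> (\<lambda>u. u - (p + q)) ` (subdifferential J x + subdifferential G x)" by blast
qed

text \<open>The gauge of \<open>A + B\<close> is the infimum over the decompositions of \<open>u\<close> of the larger of the two
gauges. A decomposition at scale \<open>r\<close> for \<open>A\<close> and \<open>B\<close> turns into one at any scale above
\<open>(1 + c) r\<close> for \<open>A'\<close> and \<open>B'\<close>.\<close>

lemma gauge_fun_set_plus_ratio_le:
  fixes A B A' B' :: "'a::euclidean_space set" and c :: real
  assumes A: "convex A" "0 \<in> A" and B: "convex B" "0 \<in> B"
    and A': "convex A'" "0 \<in> A'" and B': "convex B'" "0 \<in> B'" and "0 \<le> c"
    and ratA: "\<And>a. a \<in> A \<Longrightarrow> gauge_fun A' a \<le> ereal (1 + c) * gauge_fun A a"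
    and ratB: "\<And>b. b \<in> B \<Longrightarrow> gauge_fun B' b \<le> ereal (1 + c) * gauge_fun B b"
  shows "gauge_fun (A' + B') u \<le> ereal (1 + c) * gauge_fun (A + B) u"
proof (rule ereal_le_via_reals)
  fix t assume t: "ereal (1 + c) * gauge_fun (A + B) u < ereal t"
  have AB: "convex (A + B)" "0 \<in> A + B"
    using convex_set_plus[OF A(1) B(1)] set_plus_intro[OF A(2) B(2)] by simp_all
  have le1: "gauge_fun D d \<le> 1" if "d \<in> D" for d and D :: "'a set"
    using gauge_fun_le[OF that, of 1] by (simp add: one_ereal_def)
  obtain r where r: "gauge_fun (A + B) u < ereal r" "(1 + c) * r < t"
  proof -
    obtain g where g: "gauge_fun (A + B) u = ereal g" "(1 + c) * g < t"
      using t gauge_fun_nonneg[of "A + B" u] \<open>0 \<le> c\<close>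
      by (cases "gauge_fun (A + B) u") simp_all
    then have "g < t / (1 + c)" using \<open>0 \<le> c\<close> by (simp add: pos_less_divide_eq mult.commute)
    then obtain r where "g < r" "r < t / (1 + c)" using dense by blast
    then show ?thesis using that[of r] g \<open>0 \<le> c\<close> by (simp add: pos_less_divide_eq mult.commute)
  qed
  obtain w where w: "w \<in> A + B" "u = r *\<^sub>R w" "0 < r"
    using gauge_fun_lessD[OF AB r(1)] by blast
  from w(1) obtain a b where wab: "w = a + b" and "a \<in> A" "b \<in> B" by (rule set_plus_elim)
  with w have ab: "a \<in> A" "b \<in> B" "u = r *\<^sub>R (a + b)" "0 < r" by simp_all
  \<comment> \<open>The factor that is left for passing from \<open>A\<close>, \<open>B\<close> to \<open>A'\<close>, \<open>B'\<close>; it exceeds \<open>1 + c\<close>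
    strictly, so that the gauges below \<open>s\<close> have witnesses.\<close>
  define s where "s = t / r"
  have s: "1 + c < s" using r(2) ab(4) by (simp add: s_def pos_less_divide_eq)
  have *: "gauge_fun D' d < ereal s"
    if "d \<in> D" "gauge_fun D' d \<le> ereal (1 + c) * gauge_fun D d" for d and D D' :: "'a set"
  proof -
    have "ereal (1 + c) * gauge_fun D d \<le> ereal (1 + c) * 1"
      using le1[OF that(1)] \<open>0 \<le> c\<close> by (intro ereal_mult_left_mono) auto
    with that(2) have "gauge_fun D' d \<le> ereal (1 + c)" by simp
    then show ?thesis using s by (auto intro: le_less_trans)
  qed
  obtain a' where a': "a' \<in> A'" "a = s *\<^sub>R a'"
    using gauge_fun_lessD[OF A' *[OF ab(1) ratA[OF ab(1)]]] by blast
  obtain b' where b': "b' \<in> B'" "b = s *\<^sub>R b'"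
    using gauge_fun_lessD[OF B' *[OF ab(2) ratB[OF ab(2)]]] by blast
  have "0 \<le> (1 + c) * r" using \<open>0 \<le> c\<close> ab(4) by simp
  then have "0 < t" using r(2) by linarith
  have "u = t *\<^sub>R (a' + b')"
    using ab(3,4) by (simp add: a' b' s_def scaleR_add_right)
  then show "gauge_fun (A' + B') u \<le> ereal t"
    using gauge_fun_le[OF set_plus_intro[OF a'(1) b'(1)] \<open>0 < t\<close>] by simp
qed

section \<open>Smoothness relative to a subspace\<close>

lemma C2_on_bounded_linear:
  fixes F :: "'a::euclidean_space \<Rightarrow> 'b::real_normed_vector"
  assumes "bounded_linear F"
  shows "C2_on F V"
  unfolding C2_on_def
proof (intro exI conjI ballI)
  show "(F has_derivative blinfun_apply ((\<lambda>_. Blinfun F) y)) (at y)" for y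
    using bounded_linear_imp_has_derivative[OF assms] by (simp add: bounded_linear_Blinfun_apply assms)
  show "((\<lambda>_. Blinfun F) has_derivative blinfun_apply ((\<lambda>_. 0) y)) (at y)" for y
    by (simp add: zero_blinfun.rep_eq)
qed (rule continuous_on_const)

lemma C2_on_subset: "C2_on F V \<Longrightarrow> W \<subseteq> V \<Longrightarrow> C2_on F W"
  unfolding C2_on_def by (meson continuous_on_subset subsetD)

lemma C2_on_add:
  assumes "C2_on F V" "C2_on G V"
  shows "C2_on (\<lambda>y. F y + G y) V"
proof -
  obtain F' F'' where F:
    "\<forall>y\<in>V. (F has_derivative blinfun_apply (F' y)) (at y)"
    "\<forall>y\<in>V. (F' has_derivative blinfun_apply (F'' y)) (at y)" "continuous_on V F''"
    using assms(1) unfolding C2_on_def by blast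
  obtain G' G'' where G:
    "\<forall>y\<in>V. (G has_derivative blinfun_apply (G' y)) (at y)"
    "\<forall>y\<in>V. (G' has_derivative blinfun_apply (G'' y)) (at y)" "continuous_on V G''"
    using assms(2) unfolding C2_on_def by blast
  show ?thesis
    unfolding C2_on_def
  proof (intro exI conjI ballI)
    fix y assume y: "y \<in> V"
    show "((\<lambda>y. F y + G y) has_derivative blinfun_apply ((\<lambda>y. F' y + G' y) y)) (at y)"
      using has_derivative_add[OF F(1)[rule_format, OF y] G(1)[rule_format, OF y]]
      by (simp add: plus_blinfun.rep_eq)
    show "((\<lambda>y. F' y + G' y) has_derivative blinfun_apply ((\<lambda>y. F'' y + G'' y) y)) (at y)"
      using has_derivative_add[OF F(2)[rule_format, OF y] G(2)[rule_format, OF y]]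
      by (simp add: plus_blinfun.rep_eq)
  qed (intro continuous_on_add F G)
qed

lemma C2_restriction_around_add:
  assumes "C2_restriction_around J M x" "C2_restriction_around G N x" "L \<subseteq> M" "L \<subseteq> N"
  shows "C2_restriction_around (\<lambda>z. J z + G z) L x"
proof -
  obtain V g where V: "open V" "x \<in> V" "C2_on g V" "\<forall>y\<in>M \<inter> V. g y = J y"
    using assms(1) unfolding C2_restriction_around_def by blast
  obtain W h where W: "open W" "x \<in> W" "C2_on h W" "\<forall>y\<in>N \<inter> W. h y = G y"
    using assms(2) unfolding C2_restriction_around_def by blast
  have "C2_on (\<lambda>y. g y + h y) (V \<inter> W)"
    by (rule C2_on_add[OF C2_on_subset[OF V(3)] C2_on_subset[OF W(3)]]) simp_all
  moreover have "\<forall>y\<in>L \<inter> (V \<inter> W). g y + h y = J y + G y"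
    using V(4) W(4) assms(3,4) by (simp add: subset_iff)
  ultimately show ?thesis
    unfolding C2_restriction_around_def using V(1,2) W(1,2)
    by (intro exI[of _ "V \<inter> W"] exI[of _ "\<lambda>y. g y + h y"]) auto
qed

text \<open>The submersion is the orthogonal projection onto \<open>T\<^sup>\<bottom>\<close>, whose kernel is \<open>T\<close>.\<close>

lemma C2_manifold_around_subspace:
  fixes T :: "'a::euclidean_space set"
  assumes T: "subspace T" and x: "x \<in> T"
  shows "C2_manifold_around T x"
proof -
  define F where "F = closest_point (T\<^sup>\<bottom>)"
  have S: "subspace (T\<^sup>\<bottom>)" by (rule subspace_orthogonal_comp)
  have bl: "bounded_linear F"
    unfolding F_def by (rule linear_conv_bounded_linear[THEN iffD1, OF closest_point_subspace_linear[OF S]])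
  have range: "range F = T\<^sup>\<bottom>"
    using closest_point_subspace_in[OF S] closest_point_subspace_id[OF S]
    unfolding F_def by (metis image_subsetI rangeI subsetI subset_antisym)
  have "frechet_derivative F (at y) = F" for y
    using frechet_derivative_at[OF bounded_linear_imp_has_derivative[OF bl]] by metis
  moreover have "F y = 0 \<longleftrightarrow> y \<in> T" for y
  proof -
    have "F y = y - closest_point T y" unfolding F_def by (rule closest_point_orthogonal_comp[OF T])
    then show ?thesis
      using closest_point_subspace_in[OF T, of y] closest_point_subspace_id[OF T, of y] by auto
  qed
  ultimately show ?thesis
    unfolding C2_manifold_around_def using x S range C2_on_bounded_linear[OF bl, of UNIV]
    by (intro conjI exI[of _ UNIV] exI[of _ "T\<^sup>\<bottom>"] exI[of _ F]) auto
qed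

text \<open>The projection onto \<open>T\<^sup>\<bottom>\<close> annihilates a curve in \<open>T\<close>, hence also its velocity. Conversely,
straight lines realise every vector of \<open>T\<close> as a velocity.\<close>

lemma tangent_space_subspace:
  fixes T :: "'a::euclidean_space set"
  assumes T: "subspace T" and x: "x \<in> T"
  shows "tangent_space T x = T"
proof (intro subset_antisym subsetI)
  fix v assume "v \<in> tangent_space T x"
  then obtain c e where v: "v = vector_derivative c (at 0)" and e: "e > 0"
    and c: "c C1_differentiable_on {-e<..<e}" "c ` {-e<..<e} \<subseteq> T"
    unfolding tangent_space_def by blast
  have "c differentiable (at 0)"
    using c(1) e by (simp add: C1_differentiable_on_eq)
  then have cv: "(c has_vector_derivative v) (at 0)"
    by (simp add: v vector_derivative_works)
  define P where "P = closest_point (T\<^sup>\<bottom>)"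
  have S: "subspace (T\<^sup>\<bottom>)" by (rule subspace_orthogonal_comp)
  have bl: "bounded_linear P"
    unfolding P_def by (rule linear_conv_bounded_linear[THEN iffD1, OF closest_point_subspace_linear[OF S]])
  have P0: "P y = 0" if "y \<in> T" for y
    using closest_point_orthogonal_comp[OF T, of y] closest_point_subspace_id[OF T that]
    by (simp add: P_def)
  have "((\<lambda>t. P (c t)) has_vector_derivative P v) (at 0)"
    by (rule bounded_linear.has_vector_derivative[OF bl cv])
  then have "((\<lambda>t. 0) has_vector_derivative P v) (at 0)"
    by (rule has_vector_derivative_transform_within_open[of _ _ _ "{-e<..<e}"])
       (use e c(2) P0 in \<open>auto simp: image_subset_iff\<close>)
  then have "P v = 0"
    using vector_derivative_unique_at has_vector_derivative_const by blast
  then have "v = closest_point T v"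
    using closest_point_orthogonal_comp[OF T, of v] by (simp add: P_def)
  then show "v \<in> T" using closest_point_subspace_in[OF T, of v] by simp
next
  fix v assume v: "v \<in> T"
  define c where "c t = x + t *\<^sub>R v" for t :: real
  have cd: "(c has_vector_derivative v) (at t)" for t
    unfolding c_def by (auto intro!: derivative_eq_intros)
  have "c C1_differentiable_on {-1<..<1}"
    unfolding C1_differentiable_on_def using cd by (intro exI[of _ "\<lambda>_. v"]) auto
  moreover have "c ` {-1<..<1} \<subseteq> T"
    using T v x by (auto simp: c_def intro: subspace_add subspace_scale)
  moreover have "vector_derivative c (at 0) = v" using cd by (rule vector_derivative_at)
  ultimately show "v \<in> tangent_space T x"
    unfolding tangent_space_def by (auto simp: c_def intro!: exI[of _ c] exI[of _ 1])
qed

section \<open>Regularity of the subdifferential of a sum\<close>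

text \<open>Inner semicontinuity is inherited from the summands by decomposing the limit \<open>u\<close>. Outer
semicontinuity is not obtained this way, since convergence of a sum says nothing about its
terms; it comes from the closed graph instead.\<close>

lemma subdifferential_add_continuous_rel:
  fixes J G :: "'a::euclidean_space \<Rightarrow> real"
  assumes J: "convex_on UNIV J" and G: "convex_on UNIV G"
    and "setvalued_continuous_rel (subdifferential J) x M"
    and "setvalued_continuous_rel (subdifferential G) x N" "L \<subseteq> M" "L \<subseteq> N"
  shows "setvalued_continuous_rel (subdifferential (\<lambda>z. J z + G z)) x L"
  unfolding setvalued_continuous_rel_def
proof (intro conjI allI impI ballI)
  fix y v u
  assume "(\<forall>k::nat. y k \<in> L \<and> v k \<in> subdifferential (\<lambda>z. J z + G z) (y k)) \<and> y \<longlonglongrightarrow> x \<and> v \<longlonglongrightarrow> u"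
  then show "u \<in> subdifferential (\<lambda>z. J z + G z) x"
    using subdifferential_closed_graph[OF convex_on_add[OF J G], of v y x u] by blast
next
  fix y :: "nat \<Rightarrow> 'a" and u
  assume u: "u \<in> subdifferential (\<lambda>z. J z + G z) x" and y: "(\<forall>k. y k \<in> L) \<and> y \<longlonglongrightarrow> x"
  obtain a b where ab: "u = a + b" "a \<in> subdifferential J x" "b \<in> subdifferential G x"
    using u unfolding subdifferential_add[OF J G] by (auto elim: set_plus_elim)
  obtain v where v: "\<forall>\<^sub>F k in sequentially. v k \<in> subdifferential J (y k)" "v \<longlonglongrightarrow> a"
    using assms(3)[unfolded setvalued_continuous_rel_def, THEN conjunct2, rule_format, OF ab(2), of y]
      y \<open>L \<subseteq> M\<close> by blast
  obtain w where w: "\<forall>\<^sub>F k in sequentially. w k \<in> subdifferential G (y k)" "w \<longlonglongrightarrow> b"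
    using assms(4)[unfolded setvalued_continuous_rel_def, THEN conjunct2, rule_format, OF ab(3), of y]
      y \<open>L \<subseteq> N\<close> by blast
  show "\<exists>v. (\<forall>\<^sub>F k in sequentially. v k \<in> subdifferential (\<lambda>z. J z + G z) (y k)) \<and> v \<longlonglongrightarrow> u"
  proof (intro exI conjI)
    show "\<forall>\<^sub>F k in sequentially. v k + w k \<in> subdifferential (\<lambda>z. J z + G z) (y k)"
      using v(1) w(1) unfolding subdifferential_add[OF J G]
      by eventually_elim (rule set_plus_intro)
    show "(\<lambda>k. v k + w k) \<longlonglongrightarrow> u" unfolding ab(1) by (intro tendsto_add v w)
  qed
qed

text \<open>The radii of the two enlargements add, and the two unit vectors combine into their convex
combination with weights proportional to \<open>\<beta>\<close> and \<open>\<gamma>\<close>.\<close>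

lemma subdiff_lipschitz_around_add:
  fixes J G :: "'a::euclidean_space \<Rightarrow> real"
  assumes J: "convex_on UNIV J" and G: "convex_on UNIV G"
    and "subdiff_lipschitz_around J x M" "subdiff_lipschitz_around G x N" "L \<subseteq> M" "L \<subseteq> N"
  shows "subdiff_lipschitz_around (\<lambda>z. J z + G z) x L"
proof -
  obtain \<beta> U where U: "0 \<le> \<beta>" "open U" "x \<in> U" "\<forall>z\<in>M \<inter> U. \<forall>z'\<in>M \<inter> U.
      subdifferential J z' \<subseteq> {a + (\<beta> * norm (z - z')) *\<^sub>R b |a b. a \<in> subdifferential J z \<and> b \<in> cball 0 1}"
    using assms(3) unfolding subdiff_lipschitz_around_def by blast
  obtain \<gamma> V where V: "0 \<le> \<gamma>" "open V" "x \<in> V" "\<forall>z\<in>N \<inter> V. \<forall>z'\<in>N \<inter> V.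
      subdifferential G z' \<subseteq> {a + (\<gamma> * norm (z - z')) *\<^sub>R b |a b. a \<in> subdifferential G z \<and> b \<in> cball 0 1}"
    using assms(4) unfolding subdiff_lipschitz_around_def by blast
  have "subdifferential (\<lambda>z. J z + G z) z' \<subseteq> {a + ((\<beta> + \<gamma>) * norm (z - z')) *\<^sub>R b |a b.
      a \<in> subdifferential (\<lambda>z. J z + G z) z \<and> b \<in> cball 0 1}"
    if z: "z \<in> L \<inter> (U \<inter> V)" "z' \<in> L \<inter> (U \<inter> V)" for z z'
  proof
    fix u assume "u \<in> subdifferential (\<lambda>z. J z + G z) z'"
    then obtain p q where pq: "u = p + q" "p \<in> subdifferential J z'" "q \<in> subdifferential G z'"
      unfolding subdifferential_add[OF J G] by (auto elim: set_plus_elim)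
    obtain a b where ab: "p = a + (\<beta> * norm (z - z')) *\<^sub>R b" "a \<in> subdifferential J z" "norm b \<le> 1"
      using U(4)[rule_format, of z z'] z assms(5) pq(2) by (auto simp: subset_iff)
    obtain c d where cd: "q = c + (\<gamma> * norm (z - z')) *\<^sub>R d" "c \<in> subdifferential G z" "norm d \<le> 1"
      using V(4)[rule_format, of z z'] z assms(6) pq(3) by (auto simp: subset_iff)
    define r where "r = (\<beta> / (\<beta> + \<gamma>)) *\<^sub>R b + (\<gamma> / (\<beta> + \<gamma>)) *\<^sub>R d"
    have ac: "a + c \<in> subdifferential (\<lambda>z. J z + G z) z"
      unfolding subdifferential_add[OF J G] using ab(2) cd(2) by (rule set_plus_intro)
    show "u \<in> {a + ((\<beta> + \<gamma>) * norm (z - z')) *\<^sub>R b |a b.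
      a \<in> subdifferential (\<lambda>z. J z + G z) z \<and> b \<in> cball 0 1}"
    \<comment> \<open>The weights in \<open>r\<close> are only meaningful for a positive denominator.\<close>
    proof (cases "\<beta> + \<gamma> = 0")
      case True
      then have "\<beta> = 0" "\<gamma> = 0" using U(1) V(1) by linarith+
      then have "u = a + c + ((\<beta> + \<gamma>) * norm (z - z')) *\<^sub>R 0" by (simp add: pq ab cd)
      then show ?thesis using ac by (intro CollectI exI[of _ "a + c"] exI[of _ 0]) auto
    next
      case False
      then have pos: "0 < \<beta> + \<gamma>" using U(1) V(1) by linarith
      have "r \<in> cball 0 1"
        unfolding r_def using U(1) V(1) pos ab(3) cd(3)
        by (intro convexD[OF convex_cball]) (auto simp flip: add_divide_distrib)
      moreover have "((\<beta> + \<gamma>) * norm (z - z')) *\<^sub>R r =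
          (\<beta> * norm (z - z')) *\<^sub>R b + (\<gamma> * norm (z - z')) *\<^sub>R d"
        using pos by (simp add: r_def scaleR_add_right mult.commute)
      then have "u = a + c + ((\<beta> + \<gamma>) * norm (z - z')) *\<^sub>R r"
        by (simp add: pq ab cd)
      ultimately show ?thesis using ac by blast
    qed
  qed
  then show ?thesis
    unfolding subdiff_lipschitz_around_def using U(1-3) V(1-3)
    by (intro exI[of _ "\<beta> + \<gamma>"] conjI exI[of _ "U \<inter> V"]) auto
qed

lemma lipschitz_ri_selection_add:
  fixes J G :: "'a::euclidean_space \<Rightarrow> real"
  assumes J: "convex_on UNIV J" and G: "convex_on UNIV G"
    and "lipschitz_ri_selection J x M \<Gamma> \<nu> f" "lipschitz_ri_selection G x N \<Delta> \<rho> g"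
    and "L \<subseteq> M" "L \<subseteq> N"
  shows "lipschitz_ri_selection (\<lambda>z. J z + G z) x L (\<lambda>v. max (\<Gamma> v) (\<Delta> v)) (min \<nu> \<rho>) (\<lambda>z. f z + g z)"
proof -
  obtain D U A where D: "D \<subseteq> M" "open U" "x \<in> U" "M \<inter> U \<subseteq> D" "{x'\<in>M. \<Gamma> (x - x') < \<nu>} \<subseteq> D"
    "\<forall>x'\<in>D. f x' \<in> rel_interior (subdifferential J x')" "A-lipschitz_on D f"
    using assms(3) unfolding lipschitz_ri_selection_def by blast
  obtain E V B where E: "E \<subseteq> N" "open V" "x \<in> V" "N \<inter> V \<subseteq> E" "{x'\<in>N. \<Delta> (x - x') < \<rho>} \<subseteq> E"
    "\<forall>x'\<in>E. g x' \<in> rel_interior (subdifferential G x')" "B-lipschitz_on E g"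
    using assms(4) unfolding lipschitz_ri_selection_def by blast
  let ?D = "L \<inter> D \<inter> E"
  have "\<exists>U. open U \<and> x \<in> U \<and> L \<inter> U \<subseteq> ?D"
    using D(2-4) E(2-4) assms(5,6) by (intro exI[of _ "U \<inter> V"]) auto
  moreover have "{x'\<in>L. max (\<Gamma> (x - x')) (\<Delta> (x - x')) < min \<nu> \<rho>} \<subseteq> ?D"
    using D(5) E(5) assms(5,6) by auto
  moreover have "f x' + g x' \<in> rel_interior (subdifferential (\<lambda>z. J z + G z) x')" if "x' \<in> ?D" for x'
    unfolding subdifferential_add[OF J G]
      rel_interior_sum[OF convex_subdifferential convex_subdifferential]
    using D(6) E(6) that by (intro set_plus_intro) auto
  moreover have "(A + B)-lipschitz_on ?D (\<lambda>z. f z + g z)"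
    using D(7) E(7) by (intro lipschitz_on_add) (auto elim: lipschitz_on_subset)
  ultimately show ?thesis
    unfolding lipschitz_ri_selection_def by (intro exI[of _ ?D]) blast
qed

lemma partly_smooth_subspace_add:
  fixes J G :: "'a::euclidean_space \<Rightarrow> real"
  assumes J: "partly_smooth J x (model_T J x)" and G: "partly_smooth G x (model_T G x)"
  shows "partly_smooth (\<lambda>z. J z + G z) x (model_T (\<lambda>z. J z + G z) x)"
proof -
  have conv: "convex_on UNIV J" "convex_on UNIV G" using J G by (simp_all add: partly_smooth_def)
  define T where "T = model_T (\<lambda>z. J z + G z) x"
  have T: "subspace T" "T \<subseteq> model_T J x" "T \<subseteq> model_T G x" "x \<in> T"
    using J G by (auto simp: T_def subspace_model_T subspace_inter model_T_add[OF conv] partly_smooth_def)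
  show ?thesis
    using J G T tangent_space_subspace[OF T(1,4)] C2_manifold_around_subspace[OF T(1,4)]
      C2_restriction_around_add[OF _ _ T(2,3)] subdifferential_add_continuous_rel[OF conv _ _ T(2,3)]
      convex_on_add[OF conv]
    unfolding partly_smooth_def T_def[symmetric] by blast
qed

section \<open>The class PSFL\<close>

lemma is_gauge_max:
  assumes "is_gauge \<Gamma>" "is_gauge \<Delta>"
  shows "is_gauge (\<lambda>v. max (\<Gamma> v) (\<Delta> v))"
proof -
  obtain C where C: "closed C" "convex C" "0 \<in> C" "\<Gamma> = gauge_fun C" using assms(1) by (rule is_gaugeE)
  obtain D where D: "closed D" "convex D" "0 \<in> D" "\<Delta> = gauge_fun D" using assms(2) by (rule is_gaugeE)
  have "(\<lambda>v. max (\<Gamma> v) (\<Delta> v)) = gauge_fun (C \<inter> D)"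
    using gauge_fun_Int[OF C(2,3) D(2,3)] C(4) D(4) by auto
  then show ?thesis
    unfolding is_gauge_def using C D by (intro exI[of _ "C \<inter> D"]) (auto intro: convex_Int)
qed

context
  fixes J :: "'a::euclidean_space \<Rightarrow> real" and x :: 'a and \<Gamma> :: "'a \<Rightarrow> ereal" and f :: "'a \<Rightarrow> 'a"
    and \<nu> \<mu> \<tau> \<xi> :: ereal
  assumes J: "J \<in> PSFL x \<Gamma> f \<nu> \<mu> \<tau> \<xi>"
begin

lemma PSFL_basic:
  shows "convex_on UNIV J" "is_gauge \<Gamma>" "finite_on \<Gamma> (model_T J x)" "coercive_on \<Gamma> (model_T J x)"
    and "0 \<le> \<nu>" "\<nu> < \<infinity>" "0 \<le> \<mu>" "\<mu> < \<infinity>" "0 \<le> \<tau>" "\<tau> < \<infinity>" "0 \<le> \<xi>" "\<xi> < \<infinity>"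
    and "partly_smooth J x (model_T J x)" "subdiff_lipschitz_around J x (model_T J x)"
    and "lipschitz_ri_selection J x (model_T J x) \<Gamma> \<nu> f" "x \<in> model_T J x"
  using J by (simp_all add: PSFL_def partly_smooth_def)

lemma PSFL_model_T_eq: "x' \<in> model_T J x \<Longrightarrow> \<Gamma> (x - x') \<le> \<nu> \<Longrightarrow> model_T J x' = model_T J x"
  using J by (simp add: PSFL_def)

text \<open>At \<open>x\<close> itself the neighbourhood in the definition is what counts: for \<open>\<nu> = 0\<close> the strict
inequality fails even at \<open>x' = x\<close>.\<close>

lemma PSFL_f_in_ri:
  shows "f x \<in> rel_interior (subdifferential J x)"
    and "x' \<in> model_T J x \<Longrightarrow> \<Gamma> (x - x') < \<nu> \<Longrightarrow> f x' \<in> rel_interior (subdifferential J x')"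
proof -
  obtain D U where D: "open U" "x \<in> U" "model_T J x \<inter> U \<subseteq> D"
    "{x' \<in> model_T J x. \<Gamma> (x - x') < \<nu>} \<subseteq> D" "\<forall>x'\<in>D. f x' \<in> rel_interior (subdifferential J x')"
    using PSFL_basic(15) unfolding lipschitz_ri_selection_def by blast
  show "f x \<in> rel_interior (subdifferential J x)"
    using D(2,3,5) PSFL_basic(16) by blast
  show "f x' \<in> rel_interior (subdifferential J x')" if "x' \<in> model_T J x" "\<Gamma> (x - x') < \<nu>"
    using D(4,5) that by blast
qed

lemma PSFL_f_in_subdifferential:
  shows "f x \<in> subdifferential J x"
    and "x' \<in> model_T J x \<Longrightarrow> \<Gamma> (x - x') < \<nu> \<Longrightarrow> f x' \<in> subdifferential J x'"
  using PSFL_f_in_ri rel_interior_subset by blast+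

text \<open>At both points the subgradient projects onto the common model subspace as the vector \<open>e\<close>.\<close>

lemma PSFL_closest_point_model_T:
  assumes "x' \<in> model_T J x" "\<Gamma> (x - x') < \<nu>"
  shows "closest_point (model_T J x) (f x - f x') = model_e J x - model_e J x'"
proof -
  have "closest_point (model_T J x) (f x - f x') =
      closest_point (model_T J x) (f x) - closest_point (model_T J x') (f x')"
    using linear_diff[OF closest_point_subspace_linear[OF subspace_model_T], of J x "f x" "f x'"]
      PSFL_model_T_eq[of x'] assms by simp
  then show ?thesis
    using PSFL_f_in_subdifferential assms by (simp add: closest_point_model_T[OF PSFL_basic(1)])
qed

context
  fixes W C :: "'a set"
  assumes W: "subspace W" "W \<subseteq> model_T J x" and C: "convex C" "0 \<in> C" "finite_on (gauge_fun C) W"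
begin

lemma PSFL_op_bound:
  shows "0 \<le> op_bound (model_T J x) \<Gamma> (gauge_fun C) (closest_point W)"
    and "op_bound (model_T J x) \<Gamma> (gauge_fun C) (closest_point W) < \<infinity>"
proof -
  obtain D where D: "0 \<in> D" "\<Gamma> = gauge_fun D" using PSFL_basic(2) by (rule is_gaugeE)
  show "0 \<le> op_bound (model_T J x) \<Gamma> (gauge_fun C) (closest_point W)"
    using D by (intro op_bound_nonneg)
      (auto simp: gauge_fun_zero gauge_fun_nonneg subspace_0 subspace_model_T)
  show "op_bound (model_T J x) \<Gamma> (gauge_fun C) (closest_point W) < \<infinity>"
    using closest_point_subspace_in[OF W(1)] norm_closest_point_subspace_le[OF W(1)]
    by (intro op_bound_finite[OF PSFL_basic(4) C(1,2) W(1) C(3)])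
qed

text \<open>The contribution of one summand to \<open>\<mu>\<^sup>H\<close> (with \<open>W = T\<^sup>H\<close>) and to the second half of \<open>\<tau>\<^sup>H\<close>
(with \<open>W = S\<^sup>H \<inter> T\<close>). The number \<open>g\<close> stands for the larger gauge \<open>\<Gamma>\<^sup>H (x - x')\<close>.\<close>

lemma PSFL_projected_e_le:
  assumes "x' \<in> model_T J x" "\<Gamma> (x - x') < \<nu>" "\<Gamma> (x - x') \<le> g"
  shows "gauge_fun C (closest_point W (model_e J x - model_e J x')) \<le>
    \<mu> * op_bound (model_T J x) \<Gamma> (gauge_fun C) (closest_point W) * g"
proof -
  let ?o = "op_bound (model_T J x) \<Gamma> (gauge_fun C) (closest_point W)"
  obtain D where D: "convex D" "0 \<in> D" "\<Gamma> = gauge_fun D" using PSFL_basic(2) by (rule is_gaugeE)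
  have "model_e J x' \<in> model_T J x'" by (rule model_e_in_model_T[OF PSFL_basic(1)])
  then have e: "model_e J x - model_e J x' \<in> model_T J x"
    using PSFL_model_T_eq[of x'] assms(1,2)
    by (intro subspace_diff subspace_model_T model_e_in_model_T PSFL_basic(1)) auto
  have "gauge_fun C (closest_point W (model_e J x - model_e J x')) \<le>
      ?o * \<Gamma> (model_e J x - model_e J x')"
    using op_bound_apply[OF D(1,2) subspace_model_T _ _ C(1,2) closest_point_subspace_linear[OF W(1)] e]
      PSFL_basic(3,4) by (simp add: D(3))
  also have "\<dots> \<le> ?o * (\<mu> * \<Gamma> (x - x'))"
    using J assms(1,2) PSFL_op_bound(1) by (intro ereal_mult_left_mono) (auto simp: PSFL_def)
  also have "\<dots> \<le> ?o * (\<mu> * g)"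
    using assms(3) PSFL_op_bound(1) PSFL_basic(7) by (intro ereal_mult_left_mono)
  also have "\<dots> = \<mu> * ?o * g" by (simp add: ac_simps)
  finally show ?thesis .
qed

end

text \<open>The contribution of one summand to \<open>\<tau>\<^sup>H\<close>, with \<open>S = S\<^sup>H\<close> and \<open>C = \<partial>H - f\<^sup>H\<close> at \<open>x\<close>. The
difference of the subgradients is split along \<open>S\<^sub>x\<close> and \<open>T\<^sub>x\<close>; as \<open>C\<close> contains \<open>\<partial>J - f\<close>, the
first part is controlled by \<open>\<tau>\<close>, and the second is a difference of vectors \<open>e\<close>.\<close>

lemma PSFL_projected_f_le:
  fixes S C :: "'a set"
  assumes S: "subspace S" "model_S J x \<subseteq> S" and C: "convex C" "finite_on (gauge_fun C) S"
    and sub: "(\<lambda>u. u - f x) ` subdifferential J x \<subseteq> C"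
    and x': "x' \<in> model_T J x" "\<Gamma> (x - x') < \<nu>" "\<Gamma> (x - x') \<le> g"
  shows "gauge_fun C (closest_point S (f x - f x')) \<le>
    \<tau> * g + \<mu> * op_bound (model_T J x) \<Gamma> (gauge_fun C) (closest_point (S \<inter> model_T J x)) * g"
proof -
  have C0: "0 \<in> C" using sub zero_in_subdiff_translate[OF PSFL_f_in_subdifferential(1)] by blast
  have W: "subspace (S \<inter> model_T J x)" "S \<inter> model_T J x \<subseteq> model_T J x"
    using S(1) subspace_model_T by (auto intro: subspace_inter)
  have finW: "finite_on (gauge_fun C) (S \<inter> model_T J x)" using C(2) by (simp add: finite_on_def)
  have "closest_point S (f x - f x') = closest_point (model_S J x) (f x - f x') +
      closest_point (S \<inter> model_T J x) (model_e J x - model_e J x')"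
    using closest_point_orthogonal_split[OF subspace_model_T S(1), of J x "f x - f x'"] S(2)
    by (simp add: orthogonal_comp_model_T[OF PSFL_basic(1)] PSFL_closest_point_model_T[OF x'(1,2)])
  then have "gauge_fun C (closest_point S (f x - f x')) \<le>
      gauge_fun C (closest_point (model_S J x) (f x - f x')) +
      gauge_fun C (closest_point (S \<inter> model_T J x) (model_e J x - model_e J x'))"
    using gauge_fun_triangle[OF C(1) C0] by simp
  moreover have "gauge_fun C (closest_point (model_S J x) (f x - f x')) \<le> \<tau> * g"
  proof -
    have "gauge_fun C (closest_point (model_S J x) (f x - f x')) \<le>
        subdiff_gauge J x (f x) (closest_point (model_S J x) (f x - f x'))"
      unfolding subdiff_gauge_def by (rule gauge_fun_antimono[OF sub])
    also have "\<dots> \<le> \<tau> * \<Gamma> (x - x')" using J x'(1,2) by (simp add: PSFL_def)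
    also have "\<dots> \<le> \<tau> * g" using x'(3) PSFL_basic(9) by (rule ereal_mult_left_mono)
    finally show ?thesis .
  qed
  ultimately show ?thesis
    using PSFL_projected_e_le[OF W C(1) C0 finW x'] by (meson add_mono order_trans)
qed

text \<open>The defining condition on \<open>\<xi>\<close>, turned into a bound on the subdifferential gauge at \<open>x'\<close>.
It is stated on \<open>\<partial>J - f\<close> at \<open>x\<close>, a subset of \<open>S\<close>, as \<open>gauge_fun_set_plus_ratio_le\<close> asks for.\<close>

lemma PSFL_gauge_ratio_le:
  assumes x': "x' \<in> model_T J x" "\<Gamma> (x - x') < \<nu>" and c: "\<xi> * \<Gamma> (x - x') \<le> ereal c" "0 \<le> c"
    and a: "a \<in> (\<lambda>u. u - f x) ` subdifferential J x"
  shows "gauge_fun ((\<lambda>u. u - f x') ` subdifferential J x') a \<le>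
    ereal (1 + c) * gauge_fun ((\<lambda>u. u - f x) ` subdifferential J x) a"
proof (cases "a = 0")
  case True
  then show ?thesis
    using zero_in_subdiff_translate[OF PSFL_f_in_subdifferential(1)]
      zero_in_subdiff_translate[OF PSFL_f_in_subdifferential(2)[OF x']]
    by (simp add: gauge_fun_zero)
next
  case False
  have aS: "a \<in> model_S J x"
    using a diff_subdifferential_in_model_S[OF PSFL_basic(1) _ PSFL_f_in_subdifferential(1)] by blast
  then have "(subdiff_gauge J x' (f x') a - subdiff_gauge J x (f x) a) / subdiff_gauge J x (f x) a \<le>
      (SUP u\<in>model_S J x - {0}. (subdiff_gauge J x' (f x') u - subdiff_gauge J x (f x) u) /
        subdiff_gauge J x (f x) u)"
    using False by (intro SUP_upper) auto
  also have "\<dots> \<le> \<xi> * \<Gamma> (x - x')" using J x' by (simp add: PSFL_def)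
  also note c(1)
  finally have "subdiff_gauge J x' (f x') a \<le> ereal (1 + c) * subdiff_gauge J x (f x) a"
    using subdiff_gauge_finite_on_model_S[OF PSFL_basic(1) PSFL_f_in_ri(1)] aS c(2)
    by (subst (asm) ereal_relative_increase_le_iff)
       (auto simp: finite_on_def subdiff_gauge_def gauge_fun_nonneg)
  then show ?thesis by (simp add: subdiff_gauge_def)
qed

end

text \<open>The estimates combine the contributions of \<open>J\<close> and \<open>G\<close> by the triangle inequality for \<open>\<Gamma>\<^sup>H\<close>
and for the subdifferential gauge of \<open>H\<close>, both of which are gauges of convex sets containing
\<open>0\<close>: of an intersection and of a Minkowski sum, respectively.\<close>

theorem PSFL_add:
  fixes J G :: "'a::euclidean_space \<Rightarrow> real" and x :: 'a
    and \<Gamma>J \<Gamma>G :: "'a \<Rightarrow> ereal" and fJ fG :: "'a \<Rightarrow> 'a"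
    and \<nu>J \<mu>J \<tau>J \<xi>J \<nu>G \<mu>G \<tau>G \<xi>G :: ereal
  assumes J: "J \<in> PSFL x \<Gamma>J fJ \<nu>J \<mu>J \<tau>J \<xi>J" and G: "G \<in> PSFL x \<Gamma>G fG \<nu>G \<mu>G \<tau>G \<xi>G"
  defines "H \<equiv> \<lambda>z. J z + G z" and "fH \<equiv> \<lambda>z. fJ z + fG z" and "\<Gamma>H \<equiv> \<lambda>v. max (\<Gamma>J v) (\<Gamma>G v)"
  defines "TJ \<equiv> model_T J x" and "TG \<equiv> model_T G x" and "TH \<equiv> model_T H x"
  defines "SH \<equiv> orthogonal_comp TH" and "Hg \<equiv> subdiff_gauge H x (fH x)"
  shows "H \<in> PSFL x \<Gamma>H fH (min \<nu>J \<nu>G)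
          (\<mu>J * op_bound TJ \<Gamma>J \<Gamma>H (closest_point TH)
            + \<mu>G * op_bound TG \<Gamma>G \<Gamma>H (closest_point TH))
          (\<tau>J + \<tau>G
            + \<mu>J * op_bound TJ \<Gamma>J Hg (closest_point (SH \<inter> TJ))
            + \<mu>G * op_bound TG \<Gamma>G Hg (closest_point (SH \<inter> TG)))
          (max \<xi>J \<xi>G)"
proof -
  note Jb = PSFL_basic[OF J] and Gb = PSFL_basic[OF G]
  have H: "convex_on UNIV H" unfolding H_def by (rule convex_on_add[OF Jb(1) Gb(1)])
  have TH_Int: "TH = TJ \<inter> TG" unfolding TH_def H_def TJ_def TG_def by (rule model_T_add[OF Jb(1) Gb(1)])
  have TH: "subspace TH" "TH \<subseteq> model_T J x" "TH \<subseteq> model_T G x"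
    using TH_Int subspace_model_T[of H x] by (auto simp: TH_def TJ_def TG_def)
  have SH_eq: "SH = model_S H x" unfolding SH_def TH_def by (rule orthogonal_comp_model_T[OF H])
  have SH: "subspace SH" "model_S J x \<subseteq> SH" "model_S G x \<subseteq> SH"
    using orthogonal_comp_anti_mono[OF TH(2)] orthogonal_comp_anti_mono[OF TH(3)]
    by (simp_all add: SH_def subspace_orthogonal_comp orthogonal_comp_model_T Jb(1) Gb(1))
  obtain CJ where CJ: "convex CJ" "0 \<in> CJ" "\<Gamma>J = gauge_fun CJ" using Jb(2) by (rule is_gaugeE)
  obtain CG where CG: "convex CG" "0 \<in> CG" "\<Gamma>G = gauge_fun CG" using Gb(2) by (rule is_gaugeE)
  \<comment> \<open>The maximum of two gauges is the gauge of the intersection.\<close>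
  define C where "C = CJ \<inter> CG"
  have C: "convex C" "0 \<in> C" using CJ CG by (auto simp: C_def convex_Int)
  have \<Gamma>H: "\<Gamma>H = gauge_fun C"
    unfolding \<Gamma>H_def C_def CJ(3) CG(3) 
    by (rule ext) (rule gauge_fun_Int[OF CJ(1,2) CG(1,2), symmetric])
  have finTH: "finite_on \<Gamma>H TH"
    using Jb(3) Gb(3) TH(2,3) unfolding finite_on_def \<Gamma>H_def max_less_iff_conj by blast
  define AJ where "AJ z = (\<lambda>u. u - fJ z) ` subdifferential J z" for z
  define AG where "AG z = (\<lambda>u. u - fG z) ` subdifferential G z" for z
  have AJ: "convex (AJ z)" for z unfolding AJ_def by (rule convex_subdiff_translate)
  have AG: "convex (AG z)" for z unfolding AG_def by (rule convex_subdiff_translate)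
  have Hgauge: "subdiff_gauge H z (fH z) = gauge_fun (AJ z + AG z)" for z
    unfolding subdiff_gauge_def H_def fH_def AJ_def AG_def
    by (simp only: subdiff_translate_add[OF Jb(1) Gb(1)])
  have Hg: "Hg = gauge_fun (AJ x + AG x)" unfolding Hg_def by (rule Hgauge)
  have AJ0: "0 \<in> AJ x" and AG0: "0 \<in> AG x"
    unfolding AJ_def AG_def
    by (rule zero_in_subdiff_translate[OF PSFL_f_in_subdifferential(1)[OF J]]
        zero_in_subdiff_translate[OF PSFL_f_in_subdifferential(1)[OF G]])+
  have AH: "convex (AJ x + AG x)" "AJ x \<subseteq> AJ x + AG x" "AG x \<subseteq> AJ x + AG x"
    using convex_set_plus[OF AJ AG] set_plus_intro[OF _ AG0, of _ "AJ x"] set_plus_intro[OF AJ0, of _ "AG x"]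
    by auto
  have subJ: "(\<lambda>u. u - fJ x) ` subdifferential J x \<subseteq> AJ x + AG x"
    using AH(2) by (simp only: AJ_def)
  have subG: "(\<lambda>u. u - fG x) ` subdifferential G x \<subseteq> AJ x + AG x"
    using AH(3) by (simp only: AG_def)
  have AH0: "0 \<in> AJ x + AG x" using AH(2) AJ0 by blast
  have ri: "fH x \<in> rel_interior (subdifferential H x)"
    unfolding fH_def H_def subdifferential_add[OF Jb(1) Gb(1)]
      rel_interior_sum[OF convex_subdifferential convex_subdifferential]
    by (rule set_plus_intro[OF PSFL_f_in_ri(1)[OF J] PSFL_f_in_ri(1)[OF G]])
  have finSH: "finite_on (gauge_fun (AJ x + AG x)) SH"
    using subdiff_gauge_finite_on_model_S[OF H ri] unfolding Hgauge SH_eq .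
  have WJ: "subspace (SH \<inter> TJ)" "SH \<inter> TJ \<subseteq> model_T J x" "finite_on (gauge_fun (AJ x + AG x)) (SH \<inter> TJ)"
    and WG: "subspace (SH \<inter> TG)" "SH \<inter> TG \<subseteq> model_T G x" "finite_on (gauge_fun (AJ x + AG x)) (SH \<inter> TG)"
    using SH(1) subspace_model_T finSH by (auto simp: TJ_def TG_def finite_on_def intro: subspace_inter)
  note opTJ = PSFL_op_bound[OF J TH(1,2) C finTH[unfolded \<Gamma>H], folded \<Gamma>H TJ_def]
    and opTG = PSFL_op_bound[OF G TH(1,3) C finTH[unfolded \<Gamma>H], folded \<Gamma>H TG_def]
    and opSJ = PSFL_op_bound[OF J WJ(1,2) AH(1) AH0 WJ(3), folded Hg TJ_def]
    and opSG = PSFL_op_bound[OF G WG(1,2) AH(1) AH0 WG(3), folded Hg TG_def]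
  note nonneg = Jb(5,7,9,11) Gb(5,7,9,11) opTJ(1) opTG(1) opSJ(1) opSG(1)
    and fin = Jb(6,8,10,12) Gb(6,8,10,12) opTJ(2) opTG(2) opSJ(2) opSG(2)
  have prod_fin: "a * b < \<infinity>" if "0 \<le> a" "a < \<infinity>" "0 \<le> b" "b < \<infinity>" for a b :: ereal
    using that by (cases a; cases b) auto

  have max_fin: "max \<xi>J \<xi>G < \<infinity>" and min_fin: "min \<nu>J \<nu>G < \<infinity>"
    using fin by (simp_all only: max_less_iff_conj min_less_iff_disj simp_thms)

  have near: "x' \<in> model_T J x \<and> x' \<in> model_T G x \<and> \<Gamma>J (x - x') < \<nu>J \<and> \<Gamma>G (x - x') < \<nu>G \<and>
      \<Gamma>J (x - x') \<le> \<Gamma>H (x - x') \<and> \<Gamma>G (x - x') \<le> \<Gamma>H (x - x')"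
    if "x' \<in> TH" "\<Gamma>H (x - x') < min \<nu>J \<nu>G" for x'
    using that TH(2,3) by (auto simp: \<Gamma>H_def)
  have T_eq: "model_T H x' = TH" if "x' \<in> TH" "\<Gamma>H (x - x') \<le> min \<nu>J \<nu>G" for x'
  proof -
    have "model_T H x' = model_T J x' \<inter> model_T G x'"
      unfolding H_def by (rule model_T_add[OF Jb(1) Gb(1)])
    also have "\<dots> = TJ \<inter> TG"
      using PSFL_model_T_eq[OF J, of x'] PSFL_model_T_eq[OF G, of x'] that TH(2,3)
      by (auto simp: \<Gamma>H_def TJ_def TG_def)
    finally show ?thesis by (simp add: TH_Int)
  qed

  have mu: "\<Gamma>H (model_e H x - model_e H x') \<le>
      (\<mu>J * op_bound TJ \<Gamma>J \<Gamma>H (closest_point TH) + \<mu>G * op_bound TG \<Gamma>G \<Gamma>H (closest_point TH)) * \<Gamma>H (x - x')"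
    if x': "x' \<in> TH" "\<Gamma>H (x - x') < min \<nu>J \<nu>G" for x'
  proof -
    note n = near[OF x']
    have eH: "model_e H z = closest_point TH (model_e J z) + closest_point TH (model_e G z)"
      if "model_T H z = TH" for z
      using model_e_add[OF Jb(1) Gb(1), of z] that by (simp add: H_def)
    have "model_e H x - model_e H x' =
        closest_point TH (model_e J x - model_e J x') + closest_point TH (model_e G x - model_e G x')"
      using eH[OF meta_eq_to_obj_eq[OF TH_def[symmetric]]] eH[OF T_eq[OF x'(1) less_imp_le[OF x'(2)]]]
      by (simp add: linear_diff[OF closest_point_subspace_linear[OF TH(1)]])
    then have "\<Gamma>H (model_e H x - model_e H x') \<le>
        \<Gamma>H (closest_point TH (model_e J x - model_e J x')) + \<Gamma>H (closest_point TH (model_e G x - model_e G x'))"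
      using gauge_fun_triangle[OF C] by (simp add: \<Gamma>H)
    also have "\<dots> \<le> \<mu>J * op_bound TJ \<Gamma>J \<Gamma>H (closest_point TH) * \<Gamma>H (x - x') +
        \<mu>G * op_bound TG \<Gamma>G \<Gamma>H (closest_point TH) * \<Gamma>H (x - x')"
      using PSFL_projected_e_le[OF J TH(1,2) C finTH[unfolded \<Gamma>H], folded \<Gamma>H TJ_def, of x']
        PSFL_projected_e_le[OF G TH(1,3) C finTH[unfolded \<Gamma>H], folded \<Gamma>H TG_def, of x'] n
      by (intro add_mono) (simp_all add: TJ_def TG_def)
    finally show ?thesis using nonneg by (simp add: ereal_left_distrib)
  qed

  have tau: "Hg (closest_point SH (fH x - fH x')) \<le>
      (\<tau>J + \<tau>G + \<mu>J * op_bound TJ \<Gamma>J Hg (closest_point (SH \<inter> TJ))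
        + \<mu>G * op_bound TG \<Gamma>G Hg (closest_point (SH \<inter> TG))) * \<Gamma>H (x - x')"
    if x': "x' \<in> TH" "\<Gamma>H (x - x') < min \<nu>J \<nu>G" for x'
  proof -
    note n = near[OF x']
    have "fH x - fH x' = (fJ x - fJ x') + (fG x - fG x')" by (simp add: fH_def)
    then have "closest_point SH (fH x - fH x') =
        closest_point SH (fJ x - fJ x') + closest_point SH (fG x - fG x')"
      by (simp only: linear_add[OF closest_point_subspace_linear[OF SH(1)]])
    then have "Hg (closest_point SH (fH x - fH x')) \<le>
        Hg (closest_point SH (fJ x - fJ x')) + Hg (closest_point SH (fG x - fG x'))"
      using gauge_fun_triangle[OF AH(1) AH0] by (simp add: Hg)
    also have "\<dots> \<le>
        (\<tau>J * \<Gamma>H (x - x') + \<mu>J * op_bound TJ \<Gamma>J Hg (closest_point (SH \<inter> TJ)) * \<Gamma>H (x - x')) +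
        (\<tau>G * \<Gamma>H (x - x') + \<mu>G * op_bound TG \<Gamma>G Hg (closest_point (SH \<inter> TG)) * \<Gamma>H (x - x'))"
      unfolding Hg TJ_def TG_def
      using n PSFL_projected_f_le[OF J SH(1,2) AH(1) finSH subJ]
        PSFL_projected_f_le[OF G SH(1,3) AH(1) finSH subG]
      by (intro add_mono[of "gauge_fun _ _"]) simp_all
    finally show ?thesis using nonneg by (simp add: ereal_left_distrib add_ac)
  qed

  have xi: "(SUP u\<in>SH - {0}. (subdiff_gauge H x' (fH x') u - Hg u) / Hg u) \<le> max \<xi>J \<xi>G * \<Gamma>H (x - x')"
    if x': "x' \<in> TH" "\<Gamma>H (x - x') < min \<nu>J \<nu>G" for x'
  proof (rule SUP_least)
    fix u assume u: "u \<in> SH - {0}"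
    note n = near[OF x']
    have H0: "0 \<le> \<Gamma>H (x - x')" "0 \<le> max \<xi>J \<xi>G"
      using nonneg by (simp_all add: \<Gamma>H gauge_fun_nonneg le_max_iff_disj)
    have "\<Gamma>H (x - x') < \<infinity>"
      using x'(2) fin(1) by (auto intro: less_trans)
    \<comment> \<open>The common factor \<open>1 + c\<close> dominates both summands' factors, which lets the gauges of
      the two summands be treated at the same scale.\<close>
    with H0 max_fin obtain c where c: "max \<xi>J \<xi>G * \<Gamma>H (x - x') = ereal c" "0 \<le> c"
      by (cases "max \<xi>J \<xi>G"; cases "\<Gamma>H (x - x')") (auto simp del: max_less_iff_conj)
    have cJ: "\<xi>J * \<Gamma>J (x - x') \<le> ereal c"
    proof -
      have "\<xi>J * \<Gamma>J (x - x') \<le> max \<xi>J \<xi>G * \<Gamma>H (x - x')"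
        using n nonneg H0 by (intro ereal_mult_mono) (auto simp: CJ(3) gauge_fun_nonneg)
      then show ?thesis by (simp add: c)
    qed
    have cG: "\<xi>G * \<Gamma>G (x - x') \<le> ereal c"
    proof -
      have "\<xi>G * \<Gamma>G (x - x') \<le> max \<xi>J \<xi>G * \<Gamma>H (x - x')"
        using n nonneg H0 by (intro ereal_mult_mono) (auto simp: CG(3) gauge_fun_nonneg)
      then show ?thesis by (simp add: c)
    qed
    have "0 \<in> AJ x'" "0 \<in> AG x'"
      unfolding AJ_def AG_def using n PSFL_f_in_subdifferential(2)[OF J] PSFL_f_in_subdifferential(2)[OF G]
      by (auto intro!: zero_in_subdiff_translate)
    then have "gauge_fun (AJ x' + AG x') u \<le> ereal (1 + c) * gauge_fun (AJ x + AG x) u"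
      using n PSFL_gauge_ratio_le[OF J _ _ cJ c(2)] PSFL_gauge_ratio_le[OF G _ _ cG c(2)]
      by (intro gauge_fun_set_plus_ratio_le[OF AJ AJ0 AG AG0 AJ _ AG _ c(2)])
         (simp_all add: AJ_def AG_def)
    then show "(subdiff_gauge H x' (fH x') u - Hg u) / Hg u \<le> max \<xi>J \<xi>G * \<Gamma>H (x - x')"
      unfolding Hgauge Hg c(1)
      using u finSH c(2) by (subst ereal_relative_increase_le_iff) (auto simp: finite_on_def gauge_fun_nonneg)
  qed

  have "coercive_on \<Gamma>H TH"
    using coercive_on_mono[OF Jb(4) TH(2)] by (simp add: \<Gamma>H_def)
  moreover have "is_gauge \<Gamma>H" unfolding \<Gamma>H_def by (rule is_gauge_max[OF Jb(2) Gb(2)])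
  moreover have "partly_smooth H x TH"
    unfolding TH_def H_def by (rule partly_smooth_subspace_add[OF Jb(13) Gb(13)])
  moreover have "subdiff_lipschitz_around H x TH"
    unfolding H_def by (rule subdiff_lipschitz_around_add[OF Jb(1) Gb(1) Jb(14) Gb(14) TH(2,3)])
  moreover have "lipschitz_ri_selection H x TH \<Gamma>H (min \<nu>J \<nu>G) fH"
    unfolding H_def \<Gamma>H_def fH_def by (rule lipschitz_ri_selection_add[OF Jb(1) Gb(1) Jb(15) Gb(15) TH(2,3)])
  ultimately show ?thesis
    unfolding PSFL_def mem_Collect_eq TH_def[symmetric] SH_eq[symmetric] Hg_def[symmetric]
    using H finTH T_eq mu tau xi nonneg fin max_fin min_fin
    by (intro conjI ballI impI)
       (auto simp: prod_fin le_max_iff_disj)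
qed

theorem proposition7:
  fixes x :: "real ^ 'n"
    and J G :: "real ^ 'n \<Rightarrow> real"
    and \<Gamma>J \<Gamma>G :: "real ^ 'n \<Rightarrow> ereal"
    and fJ fG :: "real ^ 'n \<Rightarrow> real ^ 'n"
    and \<nu>J \<mu>J \<tau>J \<xi>J \<nu>G \<mu>G \<tau>G \<xi>G :: ereal
  assumes "J \<in> PSFL x \<Gamma>J fJ \<nu>J \<mu>J \<tau>J \<xi>J"
    and "G \<in> PSFL x \<Gamma>G fG \<nu>G \<mu>G \<tau>G \<xi>G"
  shows
    "let H = (\<lambda>z. J z + G z);
         fH = (\<lambda>z. fJ z + fG z);
         \<Gamma>H = (\<lambda>v. max (\<Gamma>J v) (\<Gamma>G v));
         TJ = model_T J x; TG = model_T G x; TH = model_T H x;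
         SH = orthogonal_comp TH;
         Hg = subdiff_gauge H x (fH x)
     in H \<in> PSFL x \<Gamma>H fH
          (min \<nu>J \<nu>G)
          (\<mu>J * op_bound TJ \<Gamma>J \<Gamma>H (closest_point TH)
            + \<mu>G * op_bound TG \<Gamma>G \<Gamma>H (closest_point TH))
          (\<tau>J + \<tau>G
            + \<mu>J * op_bound TJ \<Gamma>J Hg (closest_point (SH \<inter> TJ))
            + \<mu>G * op_bound TG \<Gamma>G Hg (closest_point (SH \<inter> TG)))
          (max \<xi>J \<xi>G)"
  unfolding Let_def by (rule PSFL_add[OF assms])

end
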